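(* Let $G$ be a game structure of imperfect information with observations $\mathcal{O}$, let $H=\mathsf{Knw}(G)$, and let $\mathcal{T}\subseteq\mathcal{O}$. There exists an observation-based (randomized) almost-winning strategy for Player 1 in $G$ for the objective $\mathsf{Buchi}(\mathcal{T})$ if and only if there exists an equivalence-preserving positional almost-winning strategy for Player 1 in $H$ for the objective $\mathsf{Buchi}(B_{\mathcal{T}})$.
   Context: Game structure $G=\langle L,l_0,\Sigma,\Delta,\mathcal{O},\gamma\rangle$: $L$ finite states, $l_0$ initial, $\Sigma$ finite alphabet, $\Delta\subseteq L\times\Sigma\times L$ total, $\mathcal{O}$ finite observations, $\gamma:\mathcal{O}\to2^L\setminus\{\emptyset\}$ partitioning $L$; $\mathsf{Post}_\sigma(s)=\{\ell'\mid\exists\ell\in s:(\ell,\sigma,\ell')\in\Delta\}$. Plays from $l_0$ follow $\Delta$; Player 1 picks letters, Player 2 successors. Observation sequence of $\ell_0\sigma_0\ell_1\dots$: $o_0\sigma_0o_1\dots$ with $\ell_i\in\gamma(o_i)$. A randomized Player-1 strategy maps finite prefixes to distributions over $\Sigma$; observation-based if equal on prefixes with equal observation sequences. Randomized Player-2 strategies map (prefix, letter) to distributions over successors. A Player-1 strategy $\alpha$ is almost winning for objective $\phi$ if $\Pr^{\alpha,\beta}(\phi)=1$ for every randomized Player-2 strategy $\beta$ (from the initial state). $\mathsf{Buchi}(\mathcal{T})$ is the set of plays in which some observation of $\mathcal{T}$ occurs infinitely often. $H=\mathsf{Knw}(G)$ is the perfect-information game with states $Q=\{(s,\ell)\mid\exists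 o:s\subseteq\gamma(o),\ell\in s\}$, initial state $(\{l_0\},l_0)$, and $((s,\ell),\sigma,(s',\ell'))\in\Delta_H$ iff $s'=\mathsf{Post}_\sigma(s)\cap\gamma(o)$ for some $o\in\mathcal{O}$ and $(\ell,\sigma,\ell')\in\Delta$. $(s,\ell)\approx(s',\ell')$ iff $s=s'$; prefixes are equivalent if they have the same letters and pairwise equivalent states. A Player-1 strategy in $H$ is positional if it depends only on the last state, and equivalence-preserving if it takes equal values on equivalent prefixes. $B_{\mathcal{T}}=\{(s,\ell)\in Q\mid\exists o\in\mathcal{T}:s\subseteq\gamma(o)\}$ and $\mathsf{Buchi}(B_{\mathcal{T}})$ is the set of plays of $H$ visiting $B_{\mathcal{T}}$ infinitely often. *)

theory Defs
  imports "HOL-Probability.Probability"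
begin

section \<open>Game structures of imperfect information\<close>

record ('l, 's, 'o) game =
  states :: "'l set"
  init :: 'l
  letters :: "'s set"
  delta :: "('l \<times> 's \<times> 'l) set"
  observations :: "'o set"
  gamma :: "'o \<Rightarrow> 'l set"

definition game_structure :: "('l, 's, 'o) game \<Rightarrow> bool" where
  "game_structure G \<longleftrightarrow>
     finite (states G) \<and> init G \<in> states G \<and> finite (letters G) \<and>
     delta G \<subseteq> states G \<times> letters G \<times> states G \<and>
     (\<forall>l\<in>states G. \<forall>\<sigma>\<in>letters G. \<exists>l'\<in>states G. (l, \<sigma>, l') \<in> delta G) \<and>
     finite (observations G) \<and>
     (\<forall>b\<in>observations G. gamma G b \<noteq> {}) \<and>
     (\<Union>b\<in>observations G. gamma G b) = states G \<and>
     (\<forall>b\<in>observations G. \<forall>b'\<in>observations G. b \<noteq> b' \<longrightarrow> gamma G b \<inter> gamma G b' = {})"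

definition Post :: "('l, 's, 'o) game \<Rightarrow> 's \<Rightarrow> 'l set \<Rightarrow> 'l set" where
  "Post G \<sigma> s = {l'. \<exists>l\<in>s. (l, \<sigma>, l') \<in> delta G}"


section \<open>Plays, prefixes and strategies\<close>

text \<open>
  The play $\ell_0 \sigma_0 \ell_1 \sigma_1 \ldots$ is the sequence of the pairs $(\ell_i, \sigma_i)$;
  the prefix $\ell_0 \sigma_0 \ldots \sigma_{n-1} \ell_n$, which ends in a state, is the list of the
  first $n$ pairs together with $\ell_n$.
\<close>

type_synonym ('l, 's) play = "nat \<Rightarrow> 'l \<times> 's"
type_synonym ('l, 's) prefix = "('l \<times> 's) list \<times> 'l"
type_synonym ('l, 's) strategy1 = "('l, 's) prefix \<Rightarrow> 's pmf"
type_synonym ('l, 's) strategy2 = "('l, 's) prefix \<Rightarrow> 's \<Rightarrow> 'l pmf"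

definition plays :: "('l, 's, 'o) game \<Rightarrow> ('l, 's) play set" where
  "plays G = {\<pi>. fst (\<pi> 0) = init G \<and> (\<forall>i. (fst (\<pi> i), snd (\<pi> i), fst (\<pi> (Suc i))) \<in> delta G)}"

definition prefix_of :: "('l, 's) play \<Rightarrow> nat \<Rightarrow> ('l, 's) prefix" where
  "prefix_of \<pi> n = (map \<pi> [0..<n], fst (\<pi> n))"

definition Prefs :: "('l, 's, 'o) game \<Rightarrow> ('l, 's) prefix set" where
  "Prefs G = {prefix_of \<pi> n | \<pi> n. \<pi> \<in> plays G}"

abbreviation last_state :: "('l, 's) prefix \<Rightarrow> 'l" where
  "last_state \<rho> \<equiv> snd \<rho>"

definition obs_of :: "('l, 's, 'o) game \<Rightarrow> 'l \<Rightarrow> 'o" where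
  "obs_of G l = (THE b. b \<in> observations G \<and> l \<in> gamma G b)"

definition obs_seq :: "('l, 's, 'o) game \<Rightarrow> ('l, 's) prefix \<Rightarrow> ('o \<times> 's) list \<times> 'o" where
  "obs_seq G \<rho> = (map (\<lambda>(l, \<sigma>). (obs_of G l, \<sigma>)) (fst \<rho>), obs_of G (last_state \<rho>))"

text \<open>
  Strategies are total functions of which only the values on prefixes of plays (and, for Player 2,
  letters of the alphabet) matter.
\<close>

definition player1_strategy :: "('l, 's, 'o) game \<Rightarrow> ('l, 's) strategy1 \<Rightarrow> bool" where
  "player1_strategy G \<alpha> \<longleftrightarrow> (\<forall>\<rho>\<in>Prefs G. set_pmf (\<alpha> \<rho>) \<subseteq> letters G)"

definition player2_strategy :: "('l, 's, 'o) game \<Rightarrow> ('l, 's) strategy2 \<Rightarrow> bool" where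
  "player2_strategy G \<beta> \<longleftrightarrow>
     (\<forall>\<rho>\<in>Prefs G. \<forall>\<sigma>\<in>letters G. set_pmf (\<beta> \<rho> \<sigma>) \<subseteq> Post G \<sigma> {last_state \<rho>})"

definition observation_based :: "('l, 's, 'o) game \<Rightarrow> ('l, 's) strategy1 \<Rightarrow> bool" where
  "observation_based G \<alpha> \<longleftrightarrow>
     (\<forall>\<rho>\<in>Prefs G. \<forall>\<rho>'\<in>Prefs G. obs_seq G \<rho> = obs_seq G \<rho>' \<longrightarrow> \<alpha> \<rho> = \<alpha> \<rho>')"

definition positional :: "('l, 's, 'o) game \<Rightarrow> ('l, 's) strategy1 \<Rightarrow> bool" where
  "positional G \<alpha> \<longleftrightarrow>
     (\<forall>\<rho>\<in>Prefs G. \<forall>\<rho>'\<in>Prefs G. last_state \<rho> = last_state \<rho>' \<longrightarrow> \<alpha> \<rho> = \<alpha> \<rho>')"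


section \<open>The probability measure on plays\<close>

text \<open>
  The distribution of the pair $(\ell_i, \sigma_i)$ given the earlier pairs: Player 2 draws
  $\ell_i$ in answer to $\sigma_{i-1}$, then Player 1 draws $\sigma_i$. Histories that do not come
  from a play have probability zero, and the value there is irrelevant.
\<close>

definition step_pmf ::
  "('l, 's, 'o) game \<Rightarrow> ('l, 's) strategy1 \<Rightarrow> ('l, 's) strategy2 \<Rightarrow> nat \<Rightarrow> ('l, 's) play \<Rightarrow> ('l \<times> 's) pmf"
where
  "step_pmf G \<alpha> \<beta> i \<omega> = (case i of
     0 \<Rightarrow> map_pmf (Pair (init G)) (\<alpha> ([], init G))
   | Suc n \<Rightarrow>
       (if prefix_of \<omega> n \<in> Prefs G \<and> snd (\<omega> n) \<in> letters G
        then bind_pmf (\<beta> (prefix_of \<omega> n) (snd (\<omega> n)))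
               (\<lambda>l'. map_pmf (Pair l') (\<alpha> (map \<omega> [0..<Suc n], l')))
        else return_pmf undefined))"

definition play_measure ::
  "('l, 's, 'o) game \<Rightarrow> ('l, 's) strategy1 \<Rightarrow> ('l, 's) strategy2 \<Rightarrow> ('l, 's) play measure" where
  "play_measure G \<alpha> \<beta> =
     projective_family.lim UNIV
       (Ionescu_Tulcea.CI (\<lambda>i \<omega>. measure_pmf (step_pmf G \<alpha> \<beta> i \<omega>)) (\<lambda>_. count_space UNIV))
       (\<lambda>_. count_space UNIV)"

definition almost_winning ::
  "('l, 's, 'o) game \<Rightarrow> ('l, 's) strategy1 \<Rightarrow> ('l, 's) play set \<Rightarrow> bool" where
  "almost_winning G \<alpha> \<phi> \<longleftrightarrow>
     (\<forall>\<beta>. player2_strategy G \<beta> \<longrightarrow> measure (play_measure G \<alpha> \<beta>) \<phi> = 1)"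

definition Buchi :: "('l, 's, 'o) game \<Rightarrow> 'o set \<Rightarrow> ('l, 's) play set" where
  "Buchi G T = {\<pi> \<in> plays G. \<exists>b\<in>T. \<exists>\<^sub>\<infinity>i. fst (\<pi> i) \<in> gamma G b}"

definition Buchi_states :: "('l, 's, 'o) game \<Rightarrow> 'l set \<Rightarrow> ('l, 's) play set" where
  "Buchi_states G B = {\<pi> \<in> plays G. \<exists>\<^sub>\<infinity>i. fst (\<pi> i) \<in> B}"


section \<open>The knowledge-based construction\<close>

definition Knw_states :: "('l, 's, 'o) game \<Rightarrow> ('l set \<times> 'l) set" where
  "Knw_states G = {(s, l). \<exists>b\<in>observations G. s \<subseteq> gamma G b \<and> l \<in> s}"

text \<open>Perfect information: every state is its own observation.\<close>

definition Knw :: "('l, 's, 'o) game \<Rightarrow> ('l set \<times> 'l, 's, 'l set \<times> 'l) game" where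
  "Knw G = \<lparr>
     states = Knw_states G,
     init = ({init G}, init G),
     letters = letters G,
     delta = {((s, l), \<sigma>, (s', l')).
       (s, l) \<in> Knw_states G \<and> (s', l') \<in> Knw_states G \<and>
       (\<exists>b\<in>observations G. s' = Post G \<sigma> s \<inter> gamma G b) \<and> (l, \<sigma>, l') \<in> delta G},
     observations = Knw_states G,
     gamma = (\<lambda>q. {q}) \<rparr>"

definition state_equiv :: "'l set \<times> 'l \<Rightarrow> 'l set \<times> 'l \<Rightarrow> bool" where
  "state_equiv q q' \<longleftrightarrow> fst q = fst q'"

definition prefix_equiv :: "('l set \<times> 'l, 's) prefix \<Rightarrow> ('l set \<times> 'l, 's) prefix \<Rightarrow> bool" where
  "prefix_equiv \<rho> \<rho>' \<longleftrightarrow>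
     list_all2 (\<lambda>(q, \<sigma>) (q', \<sigma>'). state_equiv q q' \<and> \<sigma> = \<sigma>') (fst \<rho>) (fst \<rho>') \<and>
     state_equiv (last_state \<rho>) (last_state \<rho>')"

definition equivalence_preserving ::
  "('l set \<times> 'l, 's, 'o) game \<Rightarrow> ('l set \<times> 'l, 's) strategy1 \<Rightarrow> bool" where
  "equivalence_preserving H \<alpha> \<longleftrightarrow>
     (\<forall>\<rho>\<in>Prefs H. \<forall>\<rho>'\<in>Prefs H. prefix_equiv \<rho> \<rho>' \<longrightarrow> \<alpha> \<rho> = \<alpha> \<rho>')"

definition Knw_target :: "('l, 's, 'o) game \<Rightarrow> 'o set \<Rightarrow> ('l set \<times> 'l) set" where
  "Knw_target G T = {(s, l) \<in> Knw_states G. \<exists>b\<in>T. s \<subseteq> gamma G b}"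

lemma game_structure_Knw:
  assumes G: "game_structure G"
  shows "game_structure (Knw G)"
proof -
  have sub: "Knw_states G \<subseteq> Pow (states G) \<times> states G"
    using G by (fastforce simp: Knw_states_def game_structure_def)
  have fin: "finite (Knw_states G)"
    by (rule finite_subset[OF sub]) (use G in \<open>simp add: game_structure_def\<close>)
  have ini: "({init G}, init G) \<in> Knw_states G"
    using G unfolding Knw_states_def game_structure_def by blast
  have total: "\<exists>q'\<in>Knw_states G. (q, \<sigma>, q') \<in> delta (Knw G)"
    if q: "q \<in> Knw_states G" and \<sigma>: "\<sigma> \<in> letters G" for q \<sigma>
  proof -
    obtain s l where sl: "q = (s, l)" "l \<in> s" "(s, l) \<in> Knw_states G"
      using q by (auto simp: Knw_states_def)
    then have "l \<in> states G" using sub by auto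
    then obtain l' where l': "(l, \<sigma>, l') \<in> delta G" "l' \<in> states G"
      using G \<sigma> unfolding game_structure_def by blast
    then obtain b where b: "b \<in> observations G" "l' \<in> gamma G b"
      using G unfolding game_structure_def by blast
    have "l' \<in> Post G \<sigma> s \<inter> gamma G b"
      using sl l' b by (auto simp: Post_def)
    with b sl l' show ?thesis
      by (intro bexI[of _ "(Post G \<sigma> s \<inter> gamma G b, l')"]) (auto simp: Knw_def Knw_states_def)
  qed
  have fl: "finite (letters G)" and dl: "delta G \<subseteq> states G \<times> letters G \<times> states G"
    using G by (auto simp: game_structure_def)
  show ?thesis
    unfolding game_structure_def
    using fin ini total fl dl by (auto simp: Knw_def)
qed


section \<open>The play measure is well defined\<close>

text \<open>
  The locale constants behind the play measure are specified only for probability kernels, so the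
  following instance is what gives the definition its content; the cone formula identifies it.
\<close>

lemma Ionescu_Tulcea_step:
  assumes G: "game_structure G"
  shows "Ionescu_Tulcea (\<lambda>i \<omega>. measure_pmf (step_pmf G \<alpha> \<beta> i \<omega>)) (\<lambda>_. count_space UNIV)"
proof
  fix i :: nat
  let ?M = "PiM {0..<i} (\<lambda>_. count_space UNIV) :: (nat \<Rightarrow> 'a \<times> 'b) measure"
  let ?S = "subprob_algebra (count_space UNIV) :: ('a \<times> 'b) measure measure"
  let ?f = "\<lambda>\<omega>. measure_pmf (step_pmf G \<alpha> \<beta> i \<omega>)"
  define F where "F = PiE {0..<i} (\<lambda>_. states G \<times> letters G)"
  have finF: "finite F"
    using G by (auto simp: F_def game_structure_def intro!: finite_PiE)
  have single: "{\<omega>} \<in> sets ?M" if "\<omega> \<in> F" for \<omega>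
  proof -
    have "{\<omega>} = PiE {0..<i} (\<lambda>j. {\<omega> j})"
      using that by (auto simp: F_def PiE_iff extensional_def fun_eq_iff) (metis atLeastLessThan_iff le0)
    also have "\<dots> \<in> sets ?M" by (rule sets_PiM_I_finite) auto
    finally show ?thesis .
  qed
  have sub: "A \<in> sets ?M" if "A \<subseteq> F" for A
  proof -
    have "(\<Union>\<omega>\<in>A. {\<omega>}) \<in> sets ?M"
      using that finF single by (intro sets.finite_UN) (auto intro: finite_subset)
    then show ?thesis by simp
  qed
  have const: "\<exists>c. \<forall>\<omega> \<in> space ?M - F. ?f \<omega> = c"
  proof (cases i)
    case 0 then show ?thesis by (simp add: step_pmf_def)
  next
    case (Suc n)
    have "\<omega> \<in> F"
      if "prefix_of \<omega> n \<in> Prefs G" "snd (\<omega> n) \<in> letters G" "\<omega> \<in> space ?M" for \<omega> :: "nat \<Rightarrow> 'a \<times> 'b"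
    proof -
      from that(1) obtain \<pi> m where \<pi>: "\<pi> \<in> plays G" "prefix_of \<omega> n = prefix_of \<pi> m"
        by (auto simp: Prefs_def)
      then have mn: "m = n"
        by (metis prefix_of_def prod.inject length_map length_upt diff_zero)
      then have eq: "map \<omega> [0..<n] = map \<pi> [0..<n]" "fst (\<omega> n) = fst (\<pi> n)"
        using \<pi> by (auto simp: prefix_of_def)
      have mem: "\<pi> j \<in> states G \<times> letters G" for j
        using \<pi>(1) G by (cases "\<pi> j") (force simp: plays_def game_structure_def dest!: spec[of _ j])
      have "\<omega> j \<in> states G \<times> letters G" if "j < i" for j
      proof (cases "j = n")
        case True then show ?thesis
          using eq(2) mem[of n] \<open>snd (\<omega> n) \<in> letters G\<close> by (cases "\<omega> n") (auto simp: mem_Times_iff)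
      next
        case False
        then have "\<omega> j = \<pi> j" using eq(1) that Suc by simp
        then show ?thesis using mem by simp
      qed
      then show ?thesis using that(3) by (auto simp: F_def PiE_iff space_PiM)
    qed
    then show ?thesis
      by (intro exI[of _ "measure_pmf (return_pmf undefined)"]) (auto simp: step_pmf_def Suc)
  qed
  then obtain c where c: "\<And>\<omega>. \<omega> \<in> space ?M - F \<Longrightarrow> ?f \<omega> = c" by blast
  show "?f \<in> measurable ?M ?S"
  proof (rule measurableI)
    show "?f \<omega> \<in> space ?S" for \<omega>
      by (simp add: measure_pmf_in_subprob_algebra)
    fix A
    have FM: "F \<inter> space ?M \<in> sets ?M" using sub[of "F \<inter> space ?M"] by blast
    have "?f -` A \<inter> space ?M = (?f -` A \<inter> F \<inter> space ?M) \<union> (if c \<in> A then space ?M - F \<inter> space ?M else {})"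
      using c by (auto split: if_splits)
    also have "\<dots> \<in> sets ?M"
      using FM sub[of "?f -` A \<inter> F \<inter> space ?M"] by auto
    finally show "?f -` A \<inter> space ?M \<in> sets ?M" .
  qed
qed

lemma
  assumes "game_structure G"
  shows prob_space_play_measure: "prob_space (play_measure G \<alpha> \<beta>)"
    and sets_play_measure: "sets (play_measure G \<alpha> \<beta>) = sets (PiM UNIV (\<lambda>_. count_space UNIV))"
proof -
  interpret Ionescu_Tulcea "\<lambda>i \<omega>. measure_pmf (step_pmf G \<alpha> \<beta> i \<omega>)" "\<lambda>_. count_space UNIV"
    by (rule Ionescu_Tulcea_step[OF assms])
  show "sets (play_measure G \<alpha> \<beta>) = sets (PiM UNIV (\<lambda>_. count_space UNIV))"
    unfolding play_measure_def by simp
  have "prob_space (distr PF.lim (PiM {} (\<lambda>_. count_space UNIV)) (\<lambda>x. restrict x {}))"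
    by (subst distr_lim) (auto intro: PF.prob_space_P)
  then show "prob_space (play_measure G \<alpha> \<beta>)"
    unfolding play_measure_def
    by (rule prob_space_distrD[rotated])
       (auto simp: measurable_cong_sets[OF PF.sets_lim refl] intro!: measurable_restrict)
qed

lemma step_pmf_cong:
  assumes "\<And>j. j < i \<Longrightarrow> \<omega> j = \<omega>' j"
  shows "step_pmf G \<alpha> \<beta> i \<omega> = step_pmf G \<alpha> \<beta> i \<omega>'"
proof (cases i)
  case (Suc n)
  have "map \<omega> [0..<n] = map \<omega>' [0..<n]" "\<omega> n = \<omega>' n"
    using assms Suc by auto
  then show ?thesis by (simp add: step_pmf_def Suc prefix_of_def del: map_eq_conv)
qed (simp add: step_pmf_def)

lemma pmf_step_pmf_play:
  assumes G: "game_structure G" and \<pi>: "\<pi> \<in> plays G"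
  shows "pmf (step_pmf G \<alpha> \<beta> i \<pi>) (\<pi> i) =
    (case i of 0 \<Rightarrow> 1 | Suc n \<Rightarrow> pmf (\<beta> (prefix_of \<pi> n) (snd (\<pi> n))) (fst (\<pi> i))) *
    pmf (\<alpha> (prefix_of \<pi> i)) (snd (\<pi> i))"
proof (cases i)
  case 0
  have "\<pi> 0 = (init G, snd (\<pi> 0))" using \<pi> by (simp add: plays_def prod_eq_iff)
  then show ?thesis
    using pmf_map_inj'[of "Pair (init G)" "\<alpha> ([], init G)" "snd (\<pi> 0)"] \<pi>
    by (simp add: 0 step_pmf_def prefix_of_def plays_def inj_on_def)
next
  case (Suc n)
  have pre: "prefix_of \<pi> n \<in> Prefs G" using \<pi> by (auto simp: Prefs_def)
  have lett: "snd (\<pi> n) \<in> letters G"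
    using \<pi> G by (force simp: plays_def game_structure_def dest!: spec[of _ n])
  obtain l \<sigma> where ls: "\<pi> i = (l, \<sigma>)" by (cases "\<pi> i")
  let ?p = "\<beta> (prefix_of \<pi> n) (snd (\<pi> n))" and ?q = "\<lambda>l'. \<alpha> (map \<pi> [0..<Suc n], l')"
  have inj: "inj (Pair l')" for l' :: 'a by (simp add: inj_on_def)
  have m: "pmf (map_pmf (Pair l') (?q l')) (l, \<sigma>) = pmf (?q l) \<sigma> * indicator {l} l'" for l'
    by (cases "l' = l") (auto simp: pmf_map_inj'[OF inj] pmf_eq_0_set_pmf)
  have "pmf (bind_pmf ?p (\<lambda>l'. map_pmf (Pair l') (?q l'))) (l, \<sigma>) = pmf (?q l) \<sigma> * pmf ?p l"
    unfolding pmf_bind m by (simp add: measure_pmf_single)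
  then show ?thesis
    using pre lett ls by (simp add: Suc step_pmf_def prefix_of_def)
qed

lemma measure_cone:
  assumes G: "game_structure G" and \<pi>: "\<pi> \<in> plays G"
  shows "measure (play_measure G \<alpha> \<beta>) {\<omega>. \<forall>i<n. \<omega> i = \<pi> i} =
    (\<Prod>i<n. (case i of 0 \<Rightarrow> 1 | Suc m \<Rightarrow> pmf (\<beta> (prefix_of \<pi> m) (snd (\<pi> m))) (fst (\<pi> i))) *
      pmf (\<alpha> (prefix_of \<pi> i)) (snd (\<pi> i)))"
proof -
  let ?P = "\<lambda>i \<omega>. measure_pmf (step_pmf G \<alpha> \<beta> i \<omega>)" and ?M = "\<lambda>_. count_space UNIV :: ('a \<times> 'b) measure"
  interpret Ionescu_Tulcea ?P ?M by (rule Ionescu_Tulcea_step[OF G])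
  let ?r = "\<lambda>n. restrict \<pi> {0..<n}"
  have single: "{?r n} \<in> sets (PiM {0..<n} ?M)" for n
  proof -
    have "{?r n} = PiE {0..<n} (\<lambda>j. {\<pi> j})"
      by (auto simp: PiE_iff extensional_def fun_eq_iff)
    also have "\<dots> \<in> sets (PiM {0..<n} ?M)" by (rule sets_PiM_I_finite) auto
    finally show ?thesis .
  qed
  have C: "emeasure (C 0 n (\<lambda>_. undefined)) {?r n} = ennreal (\<Prod>i<n. pmf (step_pmf G \<alpha> \<beta> i \<pi>) (\<pi> i))"
  proof (induction n)
    case 0
    show ?case using single[of 0] by (simp add: emeasure_return restrict_def)
  next
    case (Suc n)
    have und: "(\<lambda>_. undefined) \<in> space (PiM {0..<0} ?M)" by (simp add: space_PiM PiE_iff extensional_def)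
    have eP: "emeasure (eP n \<omega>) {?r (Suc n)} =
        ennreal (pmf (step_pmf G \<alpha> \<beta> n \<pi>) (\<pi> n)) * indicator {?r n} \<omega>"
      if \<omega>: "\<omega> \<in> space (PiM {0..<n} ?M)" for \<omega>
    proof -
      have ext: "\<omega> \<in> extensional {0..<n}" using \<omega> by (simp add: space_PiM PiE_iff)
      have "(\<lambda>x. fun_upd \<omega> n x) -` {?r (Suc n)} = (if \<omega> = ?r n then {\<pi> n} else {})"
        using ext by (auto simp: fun_eq_iff extensional_def less_Suc_eq split: if_splits) 
      moreover have "step_pmf G \<alpha> \<beta> n (?r n) = step_pmf G \<alpha> \<beta> n \<pi>"
        by (rule step_pmf_cong) simp
      ultimately show ?thesis
        using single[of "Suc n"] by (simp add: emeasure_eP[OF \<omega>] emeasure_pmf_single)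
    qed
    have "emeasure (C 0 (Suc n) (\<lambda>_. undefined)) {?r (Suc n)}
        = (\<integral>\<^sup>+\<omega>. emeasure (eP n \<omega>) {?r (Suc n)} \<partial>C 0 n (\<lambda>_. undefined))"
      using single[of "Suc n"] measurable_eP[of n] sets_C[OF und, of n] space_C[OF und, of n]
      by (simp add: emeasure_bind[where N="PiM {0..<Suc n} ?M"] measurable_cong_sets[OF sets_C[OF und, of n] refl]
          prob_space.not_empty[OF prob_space_C[OF und]])
    also have "\<dots> = (\<integral>\<^sup>+\<omega>. ennreal (pmf (step_pmf G \<alpha> \<beta> n \<pi>) (\<pi> n)) * indicator {?r n} \<omega> \<partial>C 0 n (\<lambda>_. undefined))"
      using eP space_C[OF und, of n] by (intro nn_integral_cong) simp
    also have "\<dots> = ennreal (pmf (step_pmf G \<alpha> \<beta> n \<pi>) (\<pi> n)) * emeasure (C 0 n (\<lambda>_. undefined)) {?r n}"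
      using single[of n] sets_C[OF und, of n] by (subst nn_integral_cmult_indicator) auto
    also have "\<dots> = ennreal (\<Prod>i<Suc n. pmf (step_pmf G \<alpha> \<beta> i \<pi>) (\<pi> i))"
      by (simp add: Suc.IH ennreal_mult' [symmetric] mult.commute)
    finally show ?case .
  qed
  have "{\<omega>. \<forall>i<n. \<omega> i = \<pi> i} = prod_emb UNIV ?M {0..<n} {?r n}"
    by (auto simp: prod_emb_def fun_eq_iff restrict_def) metis
  then have "emeasure (play_measure G \<alpha> \<beta>) {\<omega>. \<forall>i<n. \<omega> i = \<pi> i} = emeasure (C 0 n (\<lambda>_. undefined)) {?r n}"
    using single[of n] sets.sets_into_space[OF single[of n]]
    by (simp add: play_measure_def lim emeasure_CI[of "{0..<n}" n] prod_emb_id space_PiM)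
  then show ?thesis
    unfolding measure_def C
    by (subst prod.cong[OF refl pmf_step_pmf_play[OF G \<pi>, symmetric]]) (auto intro!: enn2real_ennreal prod_nonneg)
qed

end

theory Submission
  imports Defs
begin

text \<open>
  Given an almost-winning strategy respecting indistinguishability, in \<open>G\<close> or in \<open>Knw G\<close>, collect
  for every knowledge set \<open>s\<close> the letters that it plays with positive probability at some reachable
  prefix with knowledge \<open>s\<close>. These letters never lead out of the reachable knowledge sets, and
  Player 2 has no trap off the target against all of them: a trap could be entered with positive
  probability and never left again. The attractor of the target then ranks all states \<open>(s, l)\<close>, and
  playing the collected letters of the current knowledge uniformly at random lowers the rank with
  probability bounded away from zero in every step, so the target is almost surely visited infinitely
  often. This strategy is positional in \<open>Knw G\<close> and observation-based in \<open>G\<close>.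
\<close>

section \<open>Finite prefixes\<close>

text \<open>The letter that lowers the rank at \<open>(s, l)\<close> depends on \<open>l\<close>,
  which Player 1 does not see. Mixing over all of \<open>A s\<close> settles this: the right letter
  is always in the mix, and the other letters do no lasting harm, since they keep the knowledge in
  \<open>W\<close>, where every state has a finite rank. The given strategy may use unbounded
  memory, whereas \<open>A\<close> merges its letters over all prefixes with the same knowledge. The
  merging is safe because a trap against all of \<open>A s\<close> is also a trap against the
  distribution played at any one prefix. That trap must be entered at a given \<open>(s, l)\<close>,
  not merely at some state with knowledge \<open>s\<close>; this is where indistinguishability is
  used (\<open>consistent_switch\<close>). The condition \<open>safe_letters\<close> mentions
  neither probabilities nor histories, so it can be extracted from either game and realized in the
  other.\<close>

definition extend :: "('l, 's) prefix \<Rightarrow> 's \<Rightarrow> 'l \<Rightarrow> ('l, 's) prefix" where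
  "extend \<rho> \<sigma> l = (fst \<rho> @ [(last_state \<rho>, \<sigma>)], l)"

lemma extend_eq_iff [simp]: "extend \<rho> \<sigma> l = extend \<rho>' \<sigma>' l' \<longleftrightarrow> \<rho> = \<rho>' \<and> \<sigma> = \<sigma>' \<and> l = l'"
  by (cases \<rho>; cases \<rho>') (auto simp: extend_def)

lemma snd_extend [simp]: "snd (extend \<rho> \<sigma> l) = l"
  and length_extend [simp]: "length (fst (extend \<rho> \<sigma> l)) = Suc (length (fst \<rho>))"
  by (simp_all add: extend_def)

lemma extend_neq_Nil [simp]: "extend \<rho> \<sigma> l \<noteq> ([], l')" "([], l') \<noteq> extend \<rho> \<sigma> l"
  by (simp_all add: extend_def)

lemma prefix_of_0: "prefix_of \<pi> 0 = ([], fst (\<pi> 0))"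
  and prefix_of_Suc: "prefix_of \<pi> (Suc n) = extend (prefix_of \<pi> n) (snd (\<pi> n)) (fst (\<pi> (Suc n)))"
  by (simp_all add: prefix_of_def extend_def)

lemma snd_prefix_of [simp]: "snd (prefix_of \<pi> n) = fst (\<pi> n)"
  and length_prefix_of [simp]: "length (fst (prefix_of \<pi> n)) = n"
  by (simp_all add: prefix_of_def)

lemma prefix_of_eq_iff:
  "prefix_of \<omega> n = prefix_of \<pi> n \<longleftrightarrow> (\<forall>i<n. \<omega> i = \<pi> i) \<and> fst (\<omega> n) = fst (\<pi> n)"
  by (auto simp: prefix_of_def)

lemma game_structureD:
  assumes "game_structure G"
  shows "finite (states G)" "init G \<in> states G" "finite (letters G)"
    "delta G \<subseteq> states G \<times> letters G \<times> states G"
    "\<And>l \<sigma>. l \<in> states G \<Longrightarrow> \<sigma> \<in> letters G \<Longrightarrow> \<exists>l'. (l, \<sigma>, l') \<in> delta G"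
    "finite (observations G)"
  using assms unfolding game_structure_def by blast+

lemma finite_delta: "game_structure G \<Longrightarrow> finite (delta G)"
  by (rule finite_subset[OF game_structureD(4)]) (simp_all add: game_structureD)

lemma delta_letter: "game_structure G \<Longrightarrow> (l, \<sigma>, l') \<in> delta G \<Longrightarrow> \<sigma> \<in> letters G"
  using game_structureD(4) by blast

text \<open>Elements of \<open>Prefs\<close> are cut from infinite plays, so finite constructions
  must be continued forever. Repeating one letter works because \<open>delta\<close> is
  total.\<close>

lemma infinite_path_exists:
  assumes G: "game_structure G" and "l \<in> states G" "letters G \<noteq> {}"
  shows "\<exists>\<pi>. fst (\<pi> 0) = l \<and> (\<forall>i. (fst (\<pi> i), snd (\<pi> i), fst (\<pi> (Suc i))) \<in> delta G)"
proof -
  obtain \<sigma> where \<sigma>: "\<sigma> \<in> letters G" using assms by blast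
  obtain nxt where nxt: "\<And>x. x \<in> states G \<Longrightarrow> (x, \<sigma>, nxt x) \<in> delta G"
    using game_structureD(5)[OF G _ \<sigma>] by metis
  have st: "(nxt ^^ i) l \<in> states G" for i
    using nxt game_structureD(4)[OF G] assms(2) by (induction i) auto
  show ?thesis
    by (rule exI[of _ "\<lambda>i. ((nxt ^^ i) l, \<sigma>)"]) (use nxt st in auto)
qed

lemma Prefs_init:
  assumes "game_structure G" "letters G \<noteq> {}"
  shows "([], init G) \<in> Prefs G"
proof -
  obtain \<pi> where "\<pi> \<in> plays G"
    using infinite_path_exists[OF assms(1) game_structureD(2)] assms by (auto simp: plays_def)
  then have "([], init G) = prefix_of \<pi> 0" by (simp add: prefix_of_0 plays_def)
  with \<open>\<pi> \<in> plays G\<close> show ?thesis unfolding Prefs_def by blast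
qed

lemma Prefs_extend:
  assumes G: "game_structure G" and \<rho>: "\<rho> \<in> Prefs G" and e: "(snd \<rho>, \<sigma>, l) \<in> delta G"
  shows "extend \<rho> \<sigma> l \<in> Prefs G"
proof -
  obtain \<pi> n where \<pi>: "\<pi> \<in> plays G" and \<rho>n: "\<rho> = prefix_of \<pi> n" using \<rho> by (auto simp: Prefs_def)
  have "l \<in> states G" "letters G \<noteq> {}" using e game_structureD(4)[OF G] by auto
  then obtain \<tau> where \<tau>: "fst (\<tau> 0) = l" "\<And>i. (fst (\<tau> i), snd (\<tau> i), fst (\<tau> (Suc i))) \<in> delta G"
    using infinite_path_exists[OF G] by blast
  \<comment> \<open>The old play is kept up to its \<open>n\<close>-th state, whose letter is
    replaced by \<sigma>; the path \<tau> starts at position \<open>Suc n\<close>, hence the shifted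
    index.\<close>
  define \<pi>' where "\<pi>' = (\<lambda>i. if i < n then \<pi> i else if i = n then (fst (\<pi> n), \<sigma>) else \<tau> (i - Suc n))"
  have "(fst (\<pi>' i), snd (\<pi>' i), fst (\<pi>' (Suc i))) \<in> delta G" for i
  proof -
    consider "Suc i < n" | "Suc i = n" | "i = n" | "i > n" by linarith
    then show ?thesis
    proof cases
      case 4
      then have "Suc i - Suc n = Suc (i - Suc n)" by simp
      then show ?thesis using 4 \<tau>(2)[of "i - Suc n"] by (simp add: \<pi>'_def)
    qed (use \<pi> e \<tau>(1) in \<open>auto simp: \<pi>'_def plays_def \<rho>n\<close>)
  qed
  moreover have "fst (\<pi>' 0) = init G" using \<pi> by (auto simp: \<pi>'_def plays_def)
  ultimately have "\<pi>' \<in> plays G" by (simp add: plays_def)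
  moreover have "prefix_of \<pi>' (Suc n) = extend \<rho> \<sigma> l"
  proof -
    have "prefix_of \<pi>' n = prefix_of \<pi> n" by (simp add: prefix_of_eq_iff \<pi>'_def)
    then show ?thesis unfolding prefix_of_Suc \<rho>n by (simp add: \<pi>'_def \<tau>(1))
  qed
  ultimately show ?thesis unfolding Prefs_def by (metis (mono_tags, lifting) mem_Collect_eq)
qed

lemma Prefs_extendD:
  assumes "extend \<rho> \<sigma> l \<in> Prefs G"
  shows "\<rho> \<in> Prefs G" "(snd \<rho>, \<sigma>, l) \<in> delta G"
proof -
  obtain \<pi> n where \<pi>: "\<pi> \<in> plays G" "extend \<rho> \<sigma> l = prefix_of \<pi> n"
    using assms by (auto simp: Prefs_def)
  then obtain m where n: "n = Suc m" by (cases n) (auto simp: prefix_of_0)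
  with \<pi> have eq: "\<rho> = prefix_of \<pi> m" "\<sigma> = snd (\<pi> m)" "l = fst (\<pi> (Suc m))" by (auto simp: prefix_of_Suc)
  then show "\<rho> \<in> Prefs G" using \<pi>(1) by (auto simp: Prefs_def)
  show "(snd \<rho>, \<sigma>, l) \<in> delta G" using \<pi>(1) by (simp add: eq plays_def)
qed

lemma Prefs_extend_iff:
  "game_structure G \<Longrightarrow> extend \<rho> \<sigma> l \<in> Prefs G \<longleftrightarrow> \<rho> \<in> Prefs G \<and> (snd \<rho>, \<sigma>, l) \<in> delta G"
  using Prefs_extend Prefs_extendD by metis

lemma Prefs_cases:
  assumes "\<rho> \<in> Prefs G"
  obtains (init) "\<rho> = ([], init G)" | (extend) \<rho>' \<sigma> l where "\<rho> = extend \<rho>' \<sigma> l" "\<rho>' \<in> Prefs G" "(snd \<rho>', \<sigma>, l) \<in> delta G"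
proof -
  obtain \<pi> n where \<pi>: "\<pi> \<in> plays G" "\<rho> = prefix_of \<pi> n" using assms by (auto simp: Prefs_def)
  show thesis
  proof (cases n)
    case 0 then show thesis using \<pi> init by (simp add: prefix_of_0 plays_def)
  next
    case (Suc m)
    then show thesis using \<pi> extend Prefs_extendD assms by (metis prefix_of_Suc)
  qed
qed

lemma Prefs_induct [consumes 1, case_names init extend]:
  assumes "\<rho> \<in> Prefs G" "P ([], init G)"
    "\<And>\<rho> \<sigma> l. \<rho> \<in> Prefs G \<Longrightarrow> P \<rho> \<Longrightarrow> (snd \<rho>, \<sigma>, l) \<in> delta G \<Longrightarrow> P (extend \<rho> \<sigma> l)"
  shows "P \<rho>"
  using assms(1)
proof (induction "length (fst \<rho>)" arbitrary: \<rho>)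
  case 0
  from 0(2) show ?case by (cases rule: Prefs_cases) (use 0 assms(2) in auto)
next
  case (Suc n)
  from Suc(3) show ?case by (cases rule: Prefs_cases) (use Suc assms(2,3) in auto)
qed

lemma Prefs_state:
  assumes "game_structure G" "\<rho> \<in> Prefs G"
  shows "snd \<rho> \<in> states G"
  using assms(2) by (cases rule: Prefs_cases) (use game_structureD(2,4)[OF assms(1)] in auto)

lemma Prefs_letter_succ:
  assumes "game_structure G" "\<rho> \<in> Prefs G" "\<sigma> \<in> letters G"
  shows "\<exists>l. (snd \<rho>, \<sigma>, l) \<in> delta G"
  using game_structureD(5)[OF assms(1)] Prefs_state[OF assms(1,2)] assms(3) by blast

text \<open>Reduces almost sure membership in \<open>plays G\<close> to countably many statements
  about finite prefixes.\<close>

lemma plays_iff_Prefs: "\<omega> \<in> plays G \<longleftrightarrow> (\<forall>n. prefix_of \<omega> n \<in> Prefs G)"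
proof
  assume *: "\<forall>n. prefix_of \<omega> n \<in> Prefs G"
  have "([], fst (\<omega> 0)) \<in> Prefs G" using *[rule_format, of 0] by (simp add: prefix_of_0)
  then have "fst (\<omega> 0) = init G" by (cases rule: Prefs_cases) auto
  moreover have "(fst (\<omega> i), snd (\<omega> i), fst (\<omega> (Suc i))) \<in> delta G" for i
    using Prefs_extendD(2) *[rule_format, of "Suc i"] by (metis prefix_of_Suc snd_prefix_of)
  ultimately show "\<omega> \<in> plays G" by (simp add: plays_def)
qed (auto simp: Prefs_def)

definition Prefs_len :: "('l, 's, 'o) game \<Rightarrow> nat \<Rightarrow> ('l, 's) prefix set" where
  "Prefs_len G n = {\<rho> \<in> Prefs G. length (fst \<rho>) = n}"

lemma Prefs_len_0_subset: "Prefs_len G 0 \<subseteq> {([], init G)}"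
proof
  fix \<rho> assume "\<rho> \<in> Prefs_len G 0"
  then have \<rho>: "\<rho> \<in> Prefs G" "length (fst \<rho>) = 0" by (auto simp: Prefs_len_def)
  from \<rho>(1) show "\<rho> \<in> {([], init G)}" by (cases rule: Prefs_cases) (use \<rho>(2) in auto)
qed

lemma Prefs_len_0:
  assumes "game_structure G" "letters G \<noteq> {}"
  shows "Prefs_len G 0 = {([], init G)}"
  using Prefs_init[OF assms] Prefs_len_0_subset[of G] by (auto simp: Prefs_len_def)

lemma Prefs_len_Suc:
  assumes "game_structure G"
  shows "Prefs_len G (Suc n) = (\<lambda>(\<rho>, \<sigma>, l). extend \<rho> \<sigma> l) `
    (SIGMA \<rho>:Prefs_len G n. SIGMA \<sigma>:letters G. Post G \<sigma> {snd \<rho>})"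
proof (intro set_eqI iffI)
  fix \<rho> assume "\<rho> \<in> Prefs_len G (Suc n)"
  then have \<rho>: "\<rho> \<in> Prefs G" "length (fst \<rho>) = Suc n" by (auto simp: Prefs_len_def)
  from \<rho>(1) show "\<rho> \<in> (\<lambda>(\<rho>, \<sigma>, l). extend \<rho> \<sigma> l) `
    (SIGMA \<rho>:Prefs_len G n. SIGMA \<sigma>:letters G. Post G \<sigma> {snd \<rho>})"
  proof (cases rule: Prefs_cases)
    case (extend \<rho>' \<sigma> l)
    then show ?thesis using \<rho>(2) delta_letter[OF assms]
      by (intro image_eqI[of _ _ "(\<rho>', \<sigma>, l)"]) (auto simp: Prefs_len_def Post_def)
  qed (use \<rho>(2) in auto)
qed (auto simp: Prefs_len_def Post_def Prefs_extend_iff[OF assms])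

lemma finite_Post:
  assumes "game_structure G"
  shows "finite (Post G \<sigma> s)"
proof (rule finite_subset)
  show "Post G \<sigma> s \<subseteq> states G" using game_structureD(4)[OF assms] by (auto simp: Post_def)
qed (rule game_structureD(1)[OF assms])

lemma finite_Prefs_len:
  assumes "game_structure G"
  shows "finite (Prefs_len G n)"
proof (induction n)
  case 0
  show ?case by (rule finite_subset[OF Prefs_len_0_subset]) simp
next
  case (Suc n)
  then show ?case
    unfolding Prefs_len_Suc[OF assms]
    using game_structureD(3)[OF assms] finite_Post[OF assms] by (intro finite_imageI finite_SigmaI) auto
qed

section \<open>Probabilities of prefixes\<close>

text \<open>The list is reversed so that the latest step is at the head and primitive recursion
  follows \<open>extend\<close>. A prefix ends in a state, so its weight contains no factor for a
  letter drawn there.\<close>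

primrec rev_weight :: "('l, 's) strategy1 \<Rightarrow> ('l, 's) strategy2 \<Rightarrow> ('l \<times> 's) list \<Rightarrow> 'l \<Rightarrow> real" where
  "rev_weight \<alpha> \<beta> [] l = 1"
| "rev_weight \<alpha> \<beta> (x # xs) l =
     rev_weight \<alpha> \<beta> xs (fst x) * pmf (\<alpha> (rev xs, fst x)) (snd x) * pmf (\<beta> (rev xs, fst x) (snd x)) l"

definition weight :: "('l, 's) strategy1 \<Rightarrow> ('l, 's) strategy2 \<Rightarrow> ('l, 's) prefix \<Rightarrow> real" where
  "weight \<alpha> \<beta> \<rho> = rev_weight \<alpha> \<beta> (rev (fst \<rho>)) (snd \<rho>)"

lemma weight_Nil [simp]: "weight \<alpha> \<beta> ([], l) = 1"
  and weight_extend: "weight \<alpha> \<beta> (extend \<rho> \<sigma> l) = weight \<alpha> \<beta> \<rho> * pmf (\<alpha> \<rho>) \<sigma> * pmf (\<beta> \<rho> \<sigma>) l"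
  by (simp_all add: weight_def extend_def)

lemma weight_nonneg: "0 \<le> weight \<alpha> \<beta> \<rho>"
proof -
  have "0 \<le> rev_weight \<alpha> \<beta> xs l" for xs l by (induction xs arbitrary: l) auto
  then show ?thesis by (simp add: weight_def)
qed

lemma measure_cone_weight:
  assumes "game_structure G" "\<pi> \<in> plays G"
  shows "measure (play_measure G \<alpha> \<beta>) {\<omega>. \<forall>i<Suc n. \<omega> i = \<pi> i}
    = weight \<alpha> \<beta> (prefix_of \<pi> n) * pmf (\<alpha> (prefix_of \<pi> n)) (snd (\<pi> n))"
  unfolding measure_cone[OF assms]
proof (induction n)
  case (Suc n)
  then show ?case
    by (subst prod.lessThan_Suc) (simp add: prefix_of_Suc weight_extend mult_ac del: prod.lessThan_Suc)
qed (simp add: prefix_of_0)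

section \<open>The play measure expressed through weights of finite prefixes\<close>

locale play =
  fixes G :: "('l, 's, 'o) game" and \<alpha> :: "('l, 's) strategy1" and \<beta> :: "('l, 's) strategy2"
  assumes game: "game_structure G"
    and nonempty: "letters G \<noteq> {}"
    and player1: "player1_strategy G \<alpha>"
    and player2: "player2_strategy G \<beta>"
begin

abbreviation "M \<equiv> play_measure G \<alpha> \<beta>"
abbreviation "q \<equiv> weight \<alpha> \<beta>"

sublocale prob_space M by (rule prob_space_play_measure[OF game])

lemma space_M [simp]: "space M = UNIV"
  using sets_eq_imp_space_eq[OF sets_play_measure[OF game, of \<alpha> \<beta>]] by (simp add: space_PiM)

lemma coord_event: "{\<omega>. P (\<omega> i)} \<in> events"
proof -
  have "(\<lambda>\<omega>. \<omega> i) \<in> measurable M (count_space UNIV)"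
    by (simp add: measurable_cong_sets[OF sets_play_measure[OF game] refl])
  from measurable_sets[OF this, of "{x. P x}"] show ?thesis by (simp add: vimage_def)
qed

lemma prefix_event: "{\<omega>. prefix_of \<omega> n = \<rho>} \<in> events"
proof (cases "length (fst \<rho>) = n")
  case True
  then have "{\<omega>. prefix_of \<omega> n = \<rho>} = (\<Inter>i\<in>{..<n}. {\<omega>. \<omega> i = fst \<rho> ! i}) \<inter> {\<omega>. fst (\<omega> n) = snd \<rho>}"
    by (cases \<rho>) (auto simp: prefix_of_def list_eq_iff_nth_eq)
  also have "\<dots> \<in> events"
    by (cases "n = 0") (auto intro!: sets.Int sets.finite_INT coord_event[of "\<lambda>x. x = y" for y]
        coord_event[of "\<lambda>x. fst x = y" for y])
  finally show ?thesis .
next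
  case False
  then have "{\<omega>. prefix_of \<omega> n = \<rho>} = {}" using length_prefix_of by blast
  then show ?thesis by (metis sets.empty_sets)
qed

lemma plays_event: "plays G \<in> events"
proof -
  have "{\<omega>. (fst (\<omega> i), snd (\<omega> i), fst (\<omega> (Suc i))) \<in> delta G} \<in> events" for i
  proof -
    \<comment> \<open>The condition couples two coordinates over arbitrary types; finiteness of
      \<open>delta G\<close> makes it a finite union of conditions on single coordinates.\<close>
    have "{\<omega>. (fst (\<omega> i), snd (\<omega> i), fst (\<omega> (Suc i))) \<in> delta G}
        = (\<Union>(l, \<sigma>, l')\<in>delta G. {\<omega>. \<omega> i = (l, \<sigma>)} \<inter> {\<omega>. fst (\<omega> (Suc i)) = l'})"
      by (auto simp: prod_eq_iff)
    also have "\<dots> \<in> events" using finite_delta[OF game] coord_event by (intro sets.finite_UN) auto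
    finally show ?thesis .
  qed
  moreover have "plays G = {\<omega>. fst (\<omega> 0) = init G} \<inter>
      (\<Inter>i. {\<omega>. (fst (\<omega> i), snd (\<omega> i), fst (\<omega> (Suc i))) \<in> delta G})"
    by (auto simp: plays_def)
  ultimately show ?thesis
    using coord_event[of "\<lambda>x. fst x = init G" 0] by (auto intro!: sets.Int sets.countable_INT'')
qed

lemma infinitely_often_event: "{\<omega>. \<exists>\<^sub>\<infinity>i. P (\<omega> i)} \<in> events"
proof -
  have "{\<omega>. \<exists>\<^sub>\<infinity>i::nat. P (\<omega> i)} = (\<Inter>m. \<Union>n\<in>{m..}. {\<omega>. P (\<omega> n)})"
    unfolding INFM_nat_le by (simp add: set_eq_iff Bex_def)
  also have "\<dots> \<in> events"
  proof (rule sets.countable_INT'')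
    show "(\<Union>n\<in>{m..}. {\<omega>. P (\<omega> n)}) \<in> events" for m
      by (rule sets.countable_UN'') (simp_all add: coord_event[of P])
  qed (use sets.top[of M] in simp_all)
  finally show ?thesis .
qed

lemma Buchi_states_event: "Buchi_states G B \<in> events"
proof -
  have "Buchi_states G B = plays G \<inter> {\<omega>. \<exists>\<^sub>\<infinity>i. fst (\<omega> i) \<in> B}" by (auto simp: Buchi_states_def)
  then show ?thesis using plays_event infinitely_often_event by auto
qed

lemma set_alpha: "\<rho> \<in> Prefs G \<Longrightarrow> set_pmf (\<alpha> \<rho>) \<subseteq> letters G"
  using player1 by (simp add: player1_strategy_def)

lemma set_beta: "\<rho> \<in> Prefs G \<Longrightarrow> \<sigma> \<in> letters G \<Longrightarrow> set_pmf (\<beta> \<rho> \<sigma>) \<subseteq> Post G \<sigma> {snd \<rho>}"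
  using player2 by (simp add: player2_strategy_def)

lemma sum_alpha: "\<rho> \<in> Prefs G \<Longrightarrow> (\<Sum>\<sigma>\<in>letters G. pmf (\<alpha> \<rho>) \<sigma>) = 1"
  by (intro sum_pmf_eq_1 set_alpha game_structureD(3)[OF game])

lemma sum_alpha': "\<rho> \<in> Prefs_len G n \<Longrightarrow> (\<Sum>\<sigma>\<in>letters G. pmf (\<alpha> \<rho>) \<sigma>) = 1"
  by (simp add: sum_alpha Prefs_len_def)

lemma sum_beta: "\<rho> \<in> Prefs G \<Longrightarrow> \<sigma> \<in> letters G \<Longrightarrow> (\<Sum>l\<in>Post G \<sigma> {snd \<rho>}. pmf (\<beta> \<rho> \<sigma>) l) = 1"
  by (intro sum_pmf_eq_1 set_beta finite_Post[OF game])

lemma sum_beta':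
  "\<rho> \<in> Prefs_len G n \<Longrightarrow> \<sigma> \<in> letters G \<Longrightarrow> (\<Sum>l\<in>Post G \<sigma> {snd \<rho>}. pmf (\<beta> \<rho> \<sigma>) l) = 1"
  by (simp add: sum_beta Prefs_len_def)

text \<open>The tower rule: an expectation over prefixes of length \<open>Suc n\<close> is an
  iterated expectation over the last letter and the last successor. Injectivity of
  \<open>extend\<close> turns the sum over the image into nested sums.\<close>

lemma sum_weight_Suc:
  "(\<Sum>\<rho>\<in>Prefs_len G (Suc n). q \<rho> * f \<rho>) = (\<Sum>\<rho>\<in>Prefs_len G n. q \<rho> *
     (\<Sum>\<sigma>\<in>letters G. pmf (\<alpha> \<rho>) \<sigma> * (\<Sum>l\<in>Post G \<sigma> {snd \<rho>}. pmf (\<beta> \<rho> \<sigma>) l * f (extend \<rho> \<sigma> l))))"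
proof -
  have inj: "inj_on (\<lambda>(\<rho>, \<sigma>, l). extend \<rho> \<sigma> l) X" for X :: "(('l, 's) prefix \<times> 's \<times> 'l) set"
    by (auto simp: inj_on_def)
  show ?thesis
    unfolding Prefs_len_Suc[OF game] sum.reindex[OF inj]
    using game_structureD(3)[OF game] finite_Post[OF game] finite_Prefs_len[OF game]
    by (simp add: sum.Sigma weight_extend sum_distrib_left mult_ac case_prod_beta o_def)
qed

lemma sum_weight: "(\<Sum>\<rho>\<in>Prefs_len G n. q \<rho>) = 1"
proof (induction n)
  case 0 then show ?case by (simp add: Prefs_len_0[OF game nonempty])
next
  case (Suc n)
  have "(\<Sum>\<rho>\<in>Prefs_len G (Suc n). q \<rho>) = (\<Sum>\<rho>\<in>Prefs_len G n. q \<rho>)"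
    using sum_weight_Suc[where f = "\<lambda>_. 1" and n = n]
    by (simp add: sum_beta' sum_alpha' cong: sum.cong)
  then show ?case using Suc by simp
qed

text \<open>The cone formula speaks of an actual play, so one through \<rho> and \<sigma> is needed.
  Any successor \<open>l\<close> will do, since it lies beyond the cone.\<close>

lemma cone_prob:
  assumes \<rho>: "\<rho> \<in> Prefs_len G n" and \<sigma>: "\<sigma> \<in> letters G"
  shows "prob {\<omega>. prefix_of \<omega> n = \<rho> \<and> snd (\<omega> n) = \<sigma>} = q \<rho> * pmf (\<alpha> \<rho>) \<sigma>"
proof -
  have \<rho>': "\<rho> \<in> Prefs G" "length (fst \<rho>) = n" using \<rho> by (auto simp: Prefs_len_def)
  obtain l where "extend \<rho> \<sigma> l \<in> Prefs G"
    using Prefs_letter_succ[OF game \<rho>'(1) \<sigma>] Prefs_extend[OF game \<rho>'(1)] by blast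
  then obtain \<pi> m where \<pi>: "\<pi> \<in> plays G" "extend \<rho> \<sigma> l = prefix_of \<pi> m" by (auto simp: Prefs_def)
  then have "m = Suc n" using \<rho>'(2) by (metis length_extend length_prefix_of)
  with \<pi> have eq: "\<rho> = prefix_of \<pi> n" "\<sigma> = snd (\<pi> n)" by (auto simp: prefix_of_Suc)
  have "{\<omega>. prefix_of \<omega> n = \<rho> \<and> snd (\<omega> n) = \<sigma>} = {\<omega>. \<forall>i<Suc n. \<omega> i = \<pi> i}"
    by (auto simp: eq prefix_of_eq_iff less_Suc_eq intro: prod_eqI)
  then show ?thesis using measure_cone_weight[OF game \<pi>(1)] by (simp add: eq)
qed

lemma cone_event: "{\<omega>. prefix_of \<omega> n = \<rho> \<and> snd (\<omega> n) = \<sigma>} \<in> events"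
proof -
  have "{\<omega>. prefix_of \<omega> n = \<rho> \<and> snd (\<omega> n) = \<sigma>} = {\<omega>. prefix_of \<omega> n = \<rho>} \<inter> {\<omega>. snd (\<omega> n) = \<sigma>}" by auto
  then show ?thesis using prefix_event[of n \<rho>] coord_event[of "\<lambda>x. snd x = \<sigma>" n] by simp
qed

text \<open>The finitely many disjoint cones over legal prefixes and letters already have total
  probability 1, so nothing need be known about the measure elsewhere.\<close>

lemma AE_prefix_letter: "AE \<omega> in M. prefix_of \<omega> n \<in> Prefs G \<and> snd (\<omega> n) \<in> letters G"
proof -
  let ?C = "\<lambda>(\<rho>, \<sigma>). {\<omega>. prefix_of \<omega> n = \<rho> \<and> snd (\<omega> n) = \<sigma>}"
  let ?I = "Prefs_len G n \<times> letters G"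
  have fin: "finite ?I" using finite_Prefs_len[OF game] game_structureD(3)[OF game] by auto
  have "prob (\<Union>x\<in>?I. ?C x) = (\<Sum>x\<in>?I. prob (?C x))"
    using fin cone_event by (intro finite_measure_finite_Union) (auto simp: disjoint_family_on_def)
  also have "\<dots> = (\<Sum>\<rho>\<in>Prefs_len G n. \<Sum>\<sigma>\<in>letters G. q \<rho> * pmf (\<alpha> \<rho>) \<sigma>)"
    by (simp add: sum.cartesian_product cone_prob case_prod_beta mem_Times_iff)
  also have "\<dots> = 1"
    using sum_weight[of n] by (simp add: sum_distrib_left[symmetric] sum_alpha' cong: sum.cong)
  finally have "AE \<omega> in M. \<omega> \<in> (\<Union>x\<in>?I. ?C x)" by (rule AE_prob_1)
  then show ?thesis by eventually_elim (auto simp: Prefs_len_def)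
qed

lemma AE_plays: "AE \<omega> in M. \<omega> \<in> plays G"
proof -
  have "AE \<omega> in M. \<forall>n. prefix_of \<omega> n \<in> Prefs G"
    unfolding AE_all_countable using AE_prefix_letter by (auto elim: eventually_mono)
  then show ?thesis by (simp add: plays_iff_Prefs)
qed

text \<open>Cones also fix the next letter; summing over it removes the last factor.\<close>

lemma prefix_prob:
  assumes \<rho>: "\<rho> \<in> Prefs_len G n"
  shows "prob {\<omega>. prefix_of \<omega> n = \<rho>} = q \<rho>"
proof -
  let ?C = "\<lambda>\<sigma>. {\<omega>. prefix_of \<omega> n = \<rho> \<and> snd (\<omega> n) = \<sigma>}"
  have "prob {\<omega>. prefix_of \<omega> n = \<rho>} = prob (\<Union>\<sigma>\<in>letters G. ?C \<sigma>)"
  proof (rule finite_measure_eq_AE)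
    show "AE \<omega> in M. (\<omega> \<in> {\<omega>. prefix_of \<omega> n = \<rho>}) = (\<omega> \<in> (\<Union>\<sigma>\<in>letters G. ?C \<sigma>))"
      using AE_prefix_letter[of n] by eventually_elim auto
    show "(\<Union>\<sigma>\<in>letters G. ?C \<sigma>) \<in> events"
      using game_structureD(3)[OF game] by (intro sets.finite_UN cone_event)
  qed (rule prefix_event)
  also have "\<dots> = (\<Sum>\<sigma>\<in>letters G. prob (?C \<sigma>))"
    using game_structureD(3)[OF game] cone_event[of n \<rho>]
    by (intro finite_measure_finite_Union) (auto simp: disjoint_family_on_def)
  also have "\<dots> = q \<rho>"
    using \<rho> by (simp add: cone_prob sum_distrib_left[symmetric] sum_alpha Prefs_len_def)
  finally show ?thesis .
qed

lemma prefix_set_event: "X \<subseteq> Prefs_len G n \<Longrightarrow> {\<omega>. prefix_of \<omega> n \<in> X} \<in> events"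
  and prefix_set_prob: "X \<subseteq> Prefs_len G n \<Longrightarrow> prob {\<omega>. prefix_of \<omega> n \<in> X} = (\<Sum>\<rho>\<in>X. q \<rho>)"
proof -
  assume X: "X \<subseteq> Prefs_len G n"
  then have fin: "finite X" using finite_Prefs_len[OF game] finite_subset by blast
  have eq: "{\<omega>. prefix_of \<omega> n \<in> X} = (\<Union>\<rho>\<in>X. {\<omega>. prefix_of \<omega> n = \<rho>})" by auto
  show "{\<omega>. prefix_of \<omega> n \<in> X} \<in> events"
    unfolding eq using fin prefix_event by (intro sets.finite_UN) auto
  have "prob {\<omega>. prefix_of \<omega> n \<in> X} = (\<Sum>\<rho>\<in>X. prob {\<omega>. prefix_of \<omega> n = \<rho>})"
    unfolding eq using fin prefix_event
    by (intro finite_measure_finite_Union) (auto simp: disjoint_family_on_def)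
  then show "prob {\<omega>. prefix_of \<omega> n \<in> X} = (\<Sum>\<rho>\<in>X. q \<rho>)"
    using X prefix_prob by (simp add: subsetD cong: sum.cong)
qed

text \<open>Each length has only finitely many prefixes of weight zero. Hence along almost every
  play all moves lie in the supports of both strategies.\<close>

lemma AE_weight_pos: "AE \<omega> in M. \<forall>n. 0 < q (prefix_of \<omega> n)"
  unfolding AE_all_countable
proof
  fix n
  let ?X = "{\<rho> \<in> Prefs_len G n. q \<rho> = 0}"
  have X: "?X \<subseteq> Prefs_len G n" by auto
  have "prob {\<omega>. prefix_of \<omega> n \<in> ?X} = 0" unfolding prefix_set_prob[OF X] by simp
  then have "AE \<omega> in M. prefix_of \<omega> n \<notin> ?X"
    using prob_eq_0[OF prefix_set_event[OF X]] by simp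
  with AE_prefix_letter[of n] show "AE \<omega> in M. 0 < q (prefix_of \<omega> n)"
    by eventually_elim (auto simp: Prefs_len_def order_less_le weight_nonneg)
qed

end

section \<open>Almost-sure Buchi winning: a trap refutes it, a rank proves it\<close>

text \<open>Player 2 is constrained by \<open>delta\<close> only, so the set is independent of
  \<beta>; it collects what some Player 2 strategy can reach with positive probability.\<close>

inductive_set consistent :: "('l, 's, 'o) game \<Rightarrow> ('l, 's) strategy1 \<Rightarrow> ('l, 's) prefix set"
  for G \<alpha> where
  init: "([], init G) \<in> consistent G \<alpha>"
| extend: "\<lbrakk>\<rho> \<in> consistent G \<alpha>; \<sigma> \<in> set_pmf (\<alpha> \<rho>); (snd \<rho>, \<sigma>, l) \<in> delta G\<rbrakk>
    \<Longrightarrow> extend \<rho> \<sigma> l \<in> consistent G \<alpha>"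

lemma consistent_Prefs:
  assumes "game_structure G" "letters G \<noteq> {}" "\<rho> \<in> consistent G \<alpha>"
  shows "\<rho> \<in> Prefs G"
  using assms(3) by induction (auto intro: Prefs_init[OF assms(1,2)] Prefs_extend[OF assms(1)])

lemma (in play) weight_pos_consistent:
  assumes "\<rho> \<in> Prefs G" "0 < q \<rho>"
  shows "\<rho> \<in> consistent G \<alpha>"
  using assms
proof (induction rule: Prefs_induct)
  case (extend \<rho> \<sigma> l)
  have "q \<rho> \<noteq> 0" "pmf (\<alpha> \<rho>) \<sigma> \<noteq> 0" using extend(4) by (auto simp: weight_extend)
  then have "0 < q \<rho>" "\<sigma> \<in> set_pmf (\<alpha> \<rho>)"
    using weight_nonneg[of \<alpha> \<beta> \<rho>] by (auto simp: set_pmf_iff)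
  then show ?case using extend by (auto intro: consistent.extend)
qed (rule consistent.init)

text \<open>Without letters there are no plays, so the objective is empty and has measure 0, while
  every Player 2 strategy is vacuously legal. This disposes of the degenerate alphabet, which the
  locales exclude.\<close>

lemma almost_winning_letters:
  assumes "game_structure G" "almost_winning G \<alpha> \<phi>" "\<phi> \<subseteq> plays G"
  shows "letters G \<noteq> {}"
proof
  assume "letters G = {}"
  then have "plays G = {}" using game_structureD(4)[OF assms(1)] by (auto simp: plays_def)
  then have "Prefs G = {}" "\<phi> = {}" using assms(3) by (auto simp: Prefs_def)
  then have "player2_strategy G undefined" by (simp add: player2_strategy_def)
  with assms(2) have "measure (play_measure G \<alpha> undefined) {} = 1"
    unfolding almost_winning_def \<open>\<phi> = {}\<close> by blast
  then show False by simp
qed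

text \<open>
  Player 2 moves uniformly until the trap \<open>Y\<close> is entered along \<open>\<rho>\<close>, and then never leaves it.
\<close>

lemma trap_not_almost_winning:
  assumes G: "game_structure G" and ne: "letters G \<noteq> {}" and \<alpha>: "player1_strategy G \<alpha>"
    and \<rho>: "\<rho> \<in> consistent G \<alpha>" "\<rho> \<in> Y"
    and trap: "\<And>\<rho> \<sigma>. \<rho> \<in> consistent G \<alpha> \<Longrightarrow> \<rho> \<in> Y \<Longrightarrow> \<sigma> \<in> set_pmf (\<alpha> \<rho>) \<Longrightarrow>
      \<exists>l. (snd \<rho>, \<sigma>, l) \<in> delta G \<and> extend \<rho> \<sigma> l \<in> Y"
    and avoid: "\<And>\<rho>. \<rho> \<in> Y \<Longrightarrow> snd \<rho> \<notin> B"
  shows "\<not> almost_winning G \<alpha> (Buchi_states G B)"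
proof
  assume aw: "almost_winning G \<alpha> (Buchi_states G B)"
  define m where "m = length (fst \<rho>)"
  \<comment> \<open>The choice must be a legal successor at every prefix, even where no move into
    \<open>Y\<close> exists, so staying in \<open>Y\<close> is demanded only conditionally.\<close>
  define stay where "stay = (\<lambda>\<rho> \<sigma>. SOME l. (snd \<rho>, \<sigma>, l) \<in> delta G \<and>
    ((\<exists>l. (snd \<rho>, \<sigma>, l) \<in> delta G \<and> extend \<rho> \<sigma> l \<in> Y) \<longrightarrow> extend \<rho> \<sigma> l \<in> Y))"
  define \<beta> where "\<beta> = (\<lambda>\<rho> \<sigma>. if length (fst \<rho>) < m then pmf_of_set (Post G \<sigma> {snd \<rho>})
    else return_pmf (stay \<rho> \<sigma>))"
  have stay: "(snd \<rho>, \<sigma>, stay \<rho> \<sigma>) \<in> delta G \<and>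
      ((\<exists>l. (snd \<rho>, \<sigma>, l) \<in> delta G \<and> extend \<rho> \<sigma> l \<in> Y) \<longrightarrow> extend \<rho> \<sigma> (stay \<rho> \<sigma>) \<in> Y)"
    if "\<rho> \<in> Prefs G" "\<sigma> \<in> letters G" for \<rho> \<sigma>
    unfolding stay_def by (rule someI_ex) (use Prefs_letter_succ[OF G that] in blast)
  have Post_ne: "Post G \<sigma> {snd \<rho>} \<noteq> {}" if "\<rho> \<in> Prefs G" "\<sigma> \<in> letters G" for \<rho> \<sigma>
    using Prefs_letter_succ[OF G that] by (auto simp: Post_def)
  have \<beta>: "player2_strategy G \<beta>"
    unfolding player2_strategy_def
  proof (intro ballI)
    fix \<rho> \<sigma> assume "\<rho> \<in> Prefs G" "\<sigma> \<in> letters G"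
    then show "set_pmf (\<beta> \<rho> \<sigma>) \<subseteq> Post G \<sigma> {snd \<rho>}"
      using stay[of \<rho> \<sigma>] set_pmf_of_set[OF Post_ne finite_Post[OF G]] by (auto simp: \<beta>_def Post_def)
  qed
  interpret play G \<alpha> \<beta> by unfold_locales (fact G ne \<alpha> \<beta>)+
  \<comment> \<open>Before length \<open>m\<close> Player 2 moves uniformly, so only the support of
    \<alpha> matters; in particular \<rho> itself gets positive weight.\<close>
  have pos: "0 < q \<tau>" if "\<tau> \<in> consistent G \<alpha>" "length (fst \<tau>) \<le> m" for \<tau>
    using that
  proof induction
    case (extend \<tau> \<sigma> l)
    then have "\<tau> \<in> Prefs G" "\<sigma> \<in> letters G" "l \<in> Post G \<sigma> {snd \<tau>}"
      using consistent_Prefs[OF G ne] delta_letter[OF G] by (auto simp: Post_def)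
    then have "0 < pmf (\<beta> \<tau> \<sigma>) l"
      using extend(5) Post_ne[of \<tau> \<sigma>] finite_Post[OF G] by (auto simp: \<beta>_def pmf_positive)
    then show ?case using extend by (simp add: weight_extend pmf_positive)
  qed simp
  have "AE \<omega> in M. prefix_of \<omega> m = \<rho> \<longrightarrow> \<omega> \<notin> Buchi_states G B"
    using AE_plays AE_weight_pos
  proof eventually_elim
    case (elim \<omega>)
    have pre: "prefix_of \<omega> n \<in> Prefs G" for n using elim(1) by (simp add: plays_iff_Prefs)
    have cons: "prefix_of \<omega> n \<in> consistent G \<alpha>" for n using weight_pos_consistent pre elim(2) by blast
    show ?case
    proof
      assume start: "prefix_of \<omega> m = \<rho>"
      have "prefix_of \<omega> (m + k) \<in> Y" for k
      proof (induction k)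
        case (Suc k)
        let ?h = "prefix_of \<omega> (m + k)" and ?\<sigma> = "snd (\<omega> (m + k))"
        have "0 < q (extend ?h ?\<sigma> (fst (\<omega> (Suc (m + k)))))"
          using elim(2) prefix_of_Suc[of \<omega> "m + k"] by metis
        then have "pmf (\<alpha> ?h) ?\<sigma> \<noteq> 0" "pmf (\<beta> ?h ?\<sigma>) (fst (\<omega> (Suc (m + k)))) \<noteq> 0"
          by (auto simp: weight_extend)
        then have \<sigma>: "?\<sigma> \<in> set_pmf (\<alpha> ?h)" and l: "fst (\<omega> (Suc (m + k))) = stay ?h ?\<sigma>"
          by (auto simp: set_pmf_iff \<beta>_def split: if_splits split_indicator_asm)
        have "?\<sigma> \<in> letters G" using set_alpha[OF pre] \<sigma> by blast
        then have "extend ?h ?\<sigma> (stay ?h ?\<sigma>) \<in> Y"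
          using trap[OF cons Suc \<sigma>] stay[OF pre] by blast
        then show ?case using l by (simp add: prefix_of_Suc)
      qed (simp add: start \<rho>)
      then have "fst (\<omega> n) \<notin> B" if "n \<ge> m" for n
        using avoid that by (metis le_Suc_ex snd_prefix_of)
      then show "\<omega> \<notin> Buchi_states G B" by (auto simp: Buchi_states_def INFM_nat_le)
    qed
  qed
  moreover have "AE \<omega> in M. \<omega> \<in> Buchi_states G B"
    using aw \<beta> by (intro AE_prob_1) (simp add: almost_winning_def)
  \<comment> \<open>After \<rho> the objective fails almost surely, yet it holds almost surely;
    hence \<rho> would have probability 0, against \<open>pos\<close>.\<close>
  ultimately have "AE \<omega> in M. prefix_of \<omega> m \<noteq> \<rho>" by eventually_elim auto
  then have "prob {\<omega>. prefix_of \<omega> m = \<rho>} = 0"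
    using prob_eq_0[OF prefix_event] by simp
  moreover have "\<rho> \<in> Prefs_len G m"
    using consistent_Prefs[OF G ne \<rho>(1)] by (simp add: Prefs_len_def m_def)
  ultimately show False using prefix_prob pos[OF \<rho>(1)] by (simp add: m_def)
qed

text \<open>
  With \<open>c = \<epsilon> / 2\<close>, as long as the target is avoided the expectation of \<open>1 - c ^ r\<close> drops in
  every step by at least \<open>c ^ N\<close>; being bounded, it can only do so finitely often.
\<close>

lemma rank_almost_winning:
  fixes r :: "('l, 's) prefix \<Rightarrow> nat" and N :: nat and \<epsilon> :: real
  assumes G: "game_structure G" and ne: "letters G \<noteq> {}" and \<alpha>: "player1_strategy G \<alpha>"
    and bound: "\<And>\<rho>. \<rho> \<in> consistent G \<alpha> \<Longrightarrow> r \<rho> \<le> N" and \<epsilon>: "0 < \<epsilon>"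
    and rank: "\<And>\<rho>. \<rho> \<in> consistent G \<alpha> \<Longrightarrow> snd \<rho> \<notin> B \<Longrightarrow>
      \<exists>\<sigma>. \<epsilon> \<le> pmf (\<alpha> \<rho>) \<sigma> \<and> (\<forall>l. (snd \<rho>, \<sigma>, l) \<in> delta G \<longrightarrow> r (extend \<rho> \<sigma> l) < r \<rho>)"
  shows "almost_winning G \<alpha> (Buchi_states G B)"
  unfolding almost_winning_def
proof (intro allI impI)
  fix \<beta> assume \<beta>: "player2_strategy G \<beta>"
  interpret play G \<alpha> \<beta> by unfold_locales (fact G ne \<alpha> \<beta>)+
  \<comment> \<open>From rank \<open>Suc k\<close> the good letter has probability at least
    \<open>2 * c\<close> and subtracts \<open>2 * c * c ^ k\<close>, twice the present
    \<open>c ^ r \<rho>\<close>, even if every other letter leads to the worst value 1. The minimum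
    with 1 ensures \<open>c < 1\<close>.\<close>
  define c where "c = min \<epsilon> 1 / 2"
  have c: "0 < c" "c < 1" "2 * c \<le> \<epsilon>" using \<epsilon> by (auto simp: c_def)
  have step: "(\<Sum>\<sigma>\<in>letters G. pmf (\<alpha> \<rho>) \<sigma> * (\<Sum>l\<in>Post G \<sigma> {snd \<rho>}. pmf (\<beta> \<rho> \<sigma>) l * f (extend \<rho> \<sigma> l)))
      \<le> (1 - c ^ r \<rho>) - c ^ N"
    if \<rho>: "\<rho> \<in> Prefs G" "0 < q \<rho>" "snd \<rho> \<notin> B" and f: "\<And>\<rho>. f \<rho> \<le> 1 - c ^ r \<rho>" for \<rho> f
  proof -
    have cons: "\<rho> \<in> consistent G \<alpha>" using weight_pos_consistent \<rho> by blast
    then obtain \<sigma>' where \<sigma>': "\<epsilon> \<le> pmf (\<alpha> \<rho>) \<sigma>'"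
      and less: "\<And>l. (snd \<rho>, \<sigma>', l) \<in> delta G \<Longrightarrow> r (extend \<rho> \<sigma>' l) < r \<rho>"
      using rank \<rho>(3) by blast
    then have "\<sigma>' \<in> set_pmf (\<alpha> \<rho>)" using \<epsilon> by (auto simp: set_pmf_iff)
    then have \<sigma>'l: "\<sigma>' \<in> letters G" using set_alpha \<rho>(1) by blast
    \<comment> \<open>The rank is positive here: the good letter has some successor, and that one
      has smaller rank.\<close>
    then obtain k where k: "r \<rho> = Suc k" using Prefs_letter_succ[OF G \<rho>(1)] less by (metis less_imp_Suc_add)
    have inner: "(\<Sum>l\<in>Post G \<sigma> {snd \<rho>}. pmf (\<beta> \<rho> \<sigma>) l * f (extend \<rho> \<sigma> l))
        \<le> 1 - (if \<sigma> = \<sigma>' then c ^ k else 0)" (is "?S \<le> ?b") if \<sigma>: "\<sigma> \<in> letters G" for \<sigma>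
    proof -
      have "f (extend \<rho> \<sigma> l) \<le> ?b" if "l \<in> Post G \<sigma> {snd \<rho>}" for l
      proof (cases "\<sigma> = \<sigma>'")
        case True
        then have "r (extend \<rho> \<sigma> l) \<le> k" using that less k by (auto simp: Post_def less_Suc_eq_le)
        then have "c ^ k \<le> c ^ r (extend \<rho> \<sigma> l)" using c by (intro power_decreasing) auto
        then show ?thesis using f[of "extend \<rho> \<sigma> l"] True by simp
      next
        case False
        have "0 \<le> c ^ r (extend \<rho> \<sigma> l)" using c by simp
        then show ?thesis using f[of "extend \<rho> \<sigma> l"] False by simp
      qed
      then have "?S \<le> (\<Sum>l\<in>Post G \<sigma> {snd \<rho>}. pmf (\<beta> \<rho> \<sigma>) l * ?b)"
        by (intro sum_mono mult_left_mono) auto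
      also have "\<dots> = ?b" using sum_beta[OF \<rho>(1) \<sigma>] by (simp add: sum_distrib_right[symmetric])
      finally show ?thesis .
    qed
    have "(\<Sum>\<sigma>\<in>letters G. pmf (\<alpha> \<rho>) \<sigma> * (\<Sum>l\<in>Post G \<sigma> {snd \<rho>}. pmf (\<beta> \<rho> \<sigma>) l * f (extend \<rho> \<sigma> l)))
        \<le> (\<Sum>\<sigma>\<in>letters G. pmf (\<alpha> \<rho>) \<sigma> * (1 - (if \<sigma> = \<sigma>' then c ^ k else 0)))"
      using inner by (intro sum_mono mult_left_mono) auto
    also have "\<dots> = (\<Sum>\<sigma>\<in>letters G. pmf (\<alpha> \<rho>) \<sigma>) - (\<Sum>\<sigma>\<in>letters G. if \<sigma> = \<sigma>' then pmf (\<alpha> \<rho>) \<sigma> * c ^ k else 0)"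
      unfolding sum_subtractf[symmetric] by (intro sum.cong) (auto simp: algebra_simps)
    also have "\<dots> = 1 - pmf (\<alpha> \<rho>) \<sigma>' * c ^ k"
      using sum_alpha[OF \<rho>(1)] \<sigma>'l game_structureD(3)[OF G] by simp
    also have "\<dots> \<le> 1 - 2 * c * c ^ k"
      using c \<sigma>' by (intro diff_left_mono mult_right_mono) auto
    also have "\<dots> = (1 - c ^ r \<rho>) - c ^ r \<rho>" by (simp add: k)
    also have "\<dots> \<le> (1 - c ^ r \<rho>) - c ^ N"
      using bound[OF cons] c by (intro diff_left_mono power_decreasing) auto
    finally show ?thesis .
  qed
  have "AE \<omega> in M. \<not> (\<forall>n\<ge>m. fst (\<omega> n) \<notin> B)" for m
  proof -
    \<comment> \<open>Prefixes that have avoided \<open>B\<close> from time \<open>m\<close> to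
      \<open>m + k\<close>. The witness \<omega> merely gives access to the states by index.\<close>
    define D where "D = (\<lambda>k. {\<rho> \<in> Prefs_len G (m + k).
      \<exists>\<omega>. prefix_of \<omega> (m + k) = \<rho> \<and> (\<forall>i\<in>{m..m + k}. fst (\<omega> i) \<notin> B)})"
    \<comment> \<open>The potential is killed at 0 once \<open>B\<close> has been visited. As
      \<open>1 - c ^ r \<rho>\<close> is nonnegative, it still bounds \<open>f k\<close> everywhere,
      as \<open>step\<close> requires.\<close>
    define f where "f = (\<lambda>k \<rho>. if \<rho> \<in> D k then 1 - c ^ r \<rho> else 0)"
    define u where "u = (\<lambda>k. \<Sum>\<rho>\<in>Prefs_len G (m + k). q \<rho> * f k \<rho>)"
    define A :: "('l, 's) play set" where "A = {\<omega>. \<forall>n\<ge>m. fst (\<omega> n) \<notin> B}"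
    have c1: "c ^ i \<le> 1" for i using c by (intro power_le_one) auto
    have D_sub: "D k \<subseteq> Prefs_len G (m + k)" for k by (auto simp: D_def)
    have D_Suc: "\<rho> \<in> D k" if ext: "extend \<rho> \<sigma> l \<in> D (Suc k)" for \<rho> \<sigma> l k
    proof -
      obtain \<omega> where \<omega>: "prefix_of \<omega> (Suc (m + k)) = extend \<rho> \<sigma> l" "\<forall>i\<in>{m..Suc (m + k)}. fst (\<omega> i) \<notin> B"
        using ext unfolding D_def mem_Collect_eq add_Suc_right by blast
      then have "prefix_of \<omega> (m + k) = \<rho>" by (simp add: prefix_of_Suc)
      moreover have "\<rho> \<in> Prefs G" "length (fst \<rho>) = m + k"
        using ext Prefs_extendD(1)[of \<rho> \<sigma> l G] by (auto simp: D_def Prefs_len_def)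
      ultimately show ?thesis using \<omega>(2) by (auto simp: D_def Prefs_len_def)
    qed
    have D_B: "snd \<rho> \<notin> B" if "\<rho> \<in> D k" for \<rho> k using that by (force simp: D_def)
    have A: "A \<in> events"
    proof -
      have "A = (\<Inter>n\<in>{m..}. {\<omega>. fst (\<omega> n) \<notin> B})" by (auto simp: A_def)
      then show ?thesis
        using coord_event[of "\<lambda>x. fst x \<notin> B"] sets.top[of M] by (auto intro!: sets.countable_INT'')
    qed
    have le: "prob A \<le> (\<Sum>\<rho>\<in>D k. q \<rho>)" for k
    proof -
      have "prob A \<le> prob {\<omega>. prefix_of \<omega> (m + k) \<in> D k}"
      proof (rule finite_measure_mono_AE)
        show "AE \<omega> in M. \<omega> \<in> A \<longrightarrow> \<omega> \<in> {\<omega>. prefix_of \<omega> (m + k) \<in> D k}"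
          using AE_prefix_letter[of "m + k"]
          by eventually_elim (auto simp: A_def D_def Prefs_len_def)
      qed (rule prefix_set_event[OF D_sub])
      then show ?thesis by (simp add: prefix_set_prob[OF D_sub])
    qed
    \<comment> \<open>Killed prefixes stay killed by \<open>D_Suc\<close> and contribute nothing.
      Each prefix of positive weight in \<open>D k\<close> loses at least \<open>c ^ N\<close>, and
      by \<open>le\<close> these prefixes weigh at least \<open>prob A\<close>.\<close>
    have drift: "u (Suc k) \<le> u k - c ^ N * prob A" for k
    proof -
      have "u (Suc k) = (\<Sum>\<rho>\<in>Prefs_len G (m + k). q \<rho> * (\<Sum>\<sigma>\<in>letters G. pmf (\<alpha> \<rho>) \<sigma> *
          (\<Sum>l\<in>Post G \<sigma> {snd \<rho>}. pmf (\<beta> \<rho> \<sigma>) l * f (Suc k) (extend \<rho> \<sigma> l))))"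
        unfolding u_def using sum_weight_Suc[of "f (Suc k)" "m + k"] by simp
      also have "\<dots> \<le> (\<Sum>\<rho>\<in>Prefs_len G (m + k). q \<rho> * (f k \<rho> - (if \<rho> \<in> D k then c ^ N else 0)))"
      proof (rule sum_mono)
        fix \<rho> assume \<rho>: "\<rho> \<in> Prefs_len G (m + k)"
        show "q \<rho> * (\<Sum>\<sigma>\<in>letters G. pmf (\<alpha> \<rho>) \<sigma> *
            (\<Sum>l\<in>Post G \<sigma> {snd \<rho>}. pmf (\<beta> \<rho> \<sigma>) l * f (Suc k) (extend \<rho> \<sigma> l)))
          \<le> q \<rho> * (f k \<rho> - (if \<rho> \<in> D k then c ^ N else 0))" (is "_ * ?S \<le> _ * ?T")
        proof (cases "q \<rho> = 0")
          case False
          then have pos: "0 < q \<rho>" using weight_nonneg[of \<alpha> \<beta> \<rho>] by simp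
          have "?S \<le> ?T"
          proof (cases "\<rho> \<in> D k")
            case True
            have "?S \<le> (1 - c ^ r \<rho>) - c ^ N"
              using \<rho> pos D_B[OF True] c1 by (intro step) (auto simp: Prefs_len_def f_def)
            then show ?thesis using True by (simp add: f_def)
          next
            case nD: False
            then have "f (Suc k) (extend \<rho> \<sigma> l) = 0" for \<sigma> l using D_Suc[of \<rho> \<sigma> l k] by (auto simp: f_def)
            then show ?thesis using nD by (simp add: f_def)
          qed
          then show ?thesis using pos by simp
        qed simp
      qed
      also have "\<dots> = u k - (\<Sum>\<rho>\<in>Prefs_len G (m + k). if \<rho> \<in> D k then q \<rho> * c ^ N else 0)"
        unfolding u_def sum_subtractf[symmetric] by (intro sum.cong) (auto simp: algebra_simps)
      also have "\<dots> = u k - c ^ N * (\<Sum>\<rho>\<in>D k. q \<rho>)"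
        using D_sub[of k] finite_Prefs_len[OF G, of "m + k"]
        by (simp add: sum.inter_restrict[symmetric] Int_absorb1 sum_distrib_left mult.commute)
      also have "\<dots> \<le> u k - c ^ N * prob A"
        using le[of k] c by (intro diff_left_mono mult_left_mono) auto
      finally show ?thesis .
    qed
    have u_le: "u k \<le> u 0 - real k * (c ^ N * prob A)" for k
    proof (induction k)
      case (Suc k) then show ?case using drift[of k] by (simp add: algebra_simps)
    qed simp
    have f01: "0 \<le> f k \<rho>" "f k \<rho> \<le> 1" for k \<rho> using c1[of "r \<rho>"] c by (auto simp: f_def)
    have "u 0 \<le> (\<Sum>\<rho>\<in>Prefs_len G (m + 0). q \<rho> * 1)"
      unfolding u_def using f01 weight_nonneg by (intro sum_mono mult_left_mono) auto
    then have "u 0 \<le> 1" by (simp add: sum_weight)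
    moreover have "0 \<le> u k" for k
      unfolding u_def using f01 weight_nonneg by (intro sum_nonneg mult_nonneg_nonneg) auto
    ultimately have bd: "real k * (c ^ N * prob A) \<le> 1" for k
      using u_le[of k] by (meson diff_ge_0_iff_ge order_trans)
    have "prob A = 0"
    proof (rule ccontr)
      assume "prob A \<noteq> 0"
      then have "0 < c ^ N * prob A" using c by (simp add: zero_less_measure_iff)
      then obtain k where "1 < real k * (c ^ N * prob A)" using reals_Archimedean3 by blast
      with bd[of k] show False by simp
    qed
    then show ?thesis using prob_eq_0[OF A] by (simp add: A_def)
  qed
  then have "AE \<omega> in M. \<forall>m. \<not> (\<forall>n\<ge>m. fst (\<omega> n) \<notin> B)" unfolding AE_all_countable by blast
  with AE_plays have "AE \<omega> in M. \<omega> \<in> Buchi_states G B"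
    by eventually_elim (auto simp: Buchi_states_def INFM_nat_le)
  then show "prob (Buchi_states G B) = 1"
    using prob_eq_1[OF Buchi_states_event] by simp
qed

section \<open>A combinatorial condition on knowledge sets\<close>

text \<open>
  Player 1 only uses letters of \<open>A s\<close> and thereby keeps the knowledge in \<open>W\<close>; nevertheless Player 2
  cannot stay off the target inside any set \<open>Z\<close> against all these letters.
\<close>

definition safe_letters :: "('l, 's, 'o) game \<Rightarrow> 'o set \<Rightarrow> 'l set set \<Rightarrow> ('l set \<Rightarrow> 's set) \<Rightarrow> bool" where
  "safe_letters G T W A \<longleftrightarrow>
     {init G} \<in> W \<and> (\<forall>s\<in>W. A s \<noteq> {} \<and> A s \<subseteq> letters G) \<and>
     (\<forall>q \<sigma> q'. fst q \<in> W \<longrightarrow> \<sigma> \<in> A (fst q) \<longrightarrow> (q, \<sigma>, q') \<in> delta (Knw G) \<longrightarrow> fst q' \<in> W) \<and>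
     (\<forall>Z. (\<forall>q\<in>Z. q \<in> Knw_states G \<and> fst q \<in> W \<and> q \<notin> Knw_target G T \<and>
            (\<forall>\<sigma>\<in>A (fst q). \<exists>q'\<in>Z. (q, \<sigma>, q') \<in> delta (Knw G))) \<longrightarrow> Z = {})"

lemma safe_lettersD:
  assumes "safe_letters G T W A"
  shows "{init G} \<in> W" "\<And>s. s \<in> W \<Longrightarrow> A s \<noteq> {}" "\<And>s. s \<in> W \<Longrightarrow> A s \<subseteq> letters G"
    "\<And>q \<sigma> q'. fst q \<in> W \<Longrightarrow> \<sigma> \<in> A (fst q) \<Longrightarrow> (q, \<sigma>, q') \<in> delta (Knw G) \<Longrightarrow> fst q' \<in> W"
    "\<And>Z. (\<And>q. q \<in> Z \<Longrightarrow> q \<in> Knw_states G \<and> fst q \<in> W \<and> q \<notin> Knw_target G T \<and>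
       (\<forall>\<sigma>\<in>A (fst q). \<exists>q'\<in>Z. (q, \<sigma>, q') \<in> delta (Knw G))) \<Longrightarrow> Z = {}"
proof -
  note * = assms[unfolded safe_letters_def]
  show "{init G} \<in> W" using * by (elim conjE)
  show "A s \<noteq> {}" "A s \<subseteq> letters G" if "s \<in> W" for s
    using *[THEN conjunct2, THEN conjunct1] that by blast+
  show "fst q' \<in> W" if "fst q \<in> W" "\<sigma> \<in> A (fst q)" "(q, \<sigma>, q') \<in> delta (Knw G)" for q \<sigma> q'
    using *[THEN conjunct2, THEN conjunct2, THEN conjunct1] that by blast
  show "Z = {}" if "\<And>q. q \<in> Z \<Longrightarrow> q \<in> Knw_states G \<and> fst q \<in> W \<and> q \<notin> Knw_target G T \<and>
       (\<forall>\<sigma>\<in>A (fst q). \<exists>q'\<in>Z. (q, \<sigma>, q') \<in> delta (Knw G))" for Z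
    using *[THEN conjunct2, THEN conjunct2, THEN conjunct2, rule_format, of Z, OF that] .
qed

lemma delta_Knw_iff:
  "((s, l), \<sigma>, (s', l')) \<in> delta (Knw G) \<longleftrightarrow>
     (s, l) \<in> Knw_states G \<and> (s', l') \<in> Knw_states G \<and>
     (\<exists>b\<in>observations G. s' = Post G \<sigma> s \<inter> gamma G b) \<and> (l, \<sigma>, l') \<in> delta G"
  by (simp add: Knw_def)

lemma Knw_simps [simp]:
  "states (Knw G) = Knw_states G" "letters (Knw G) = letters G" "init (Knw G) = ({init G}, init G)"
  by (simp_all add: Knw_def)

text \<open>A state with knowledge in \<open>W\<close> outside every attractor stage has, for each
  letter of \<open>A\<close>, a successor of the same kind. Such states form a set \<open>Z\<close>
  that the last clause of \<open>safe_letters\<close> forces to be empty.\<close>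

lemma safe_letters_rank:
  assumes G: "game_structure G" and safe: "safe_letters G T W A"
  obtains r :: "'l set \<times> 'l \<Rightarrow> nat" and N :: nat where
    "\<And>q. q \<in> Knw_states G \<Longrightarrow> r q \<le> N"
    "\<And>q. q \<in> Knw_states G \<Longrightarrow> fst q \<in> W \<Longrightarrow> q \<notin> Knw_target G T \<Longrightarrow>
       \<exists>\<sigma>\<in>A (fst q). \<forall>q'. (q, \<sigma>, q') \<in> delta (Knw G) \<longrightarrow> r q' < r q"
proof -
  note H = game_structure_Knw[OF G]
  have fin: "finite (Knw_states G)" using game_structureD(1)[OF H] by simp
  \<comment> \<open>Attractor stages: one more step is allowed in which some letter of
    \<open>A\<close> forces all successors into the previous stage.\<close>
  define S where "S = rec_nat (Knw_target G T)
    (\<lambda>_ U. U \<union> {q. \<exists>\<sigma>\<in>A (fst q). \<forall>q'. (q, \<sigma>, q') \<in> delta (Knw G) \<longrightarrow> q' \<in> U})"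
  have S0: "S 0 = Knw_target G T"
    and SS: "S (Suc n) = S n \<union> {q. \<exists>\<sigma>\<in>A (fst q). \<forall>q'. (q, \<sigma>, q') \<in> delta (Knw G) \<longrightarrow> q' \<in> S n}" for n
    by (simp_all add: S_def)
  have mono: "i \<le> j \<Longrightarrow> S i \<subseteq> S j" for i j
    by (rule lift_Suc_mono_le) (use SS in auto)
  define r where "r = (\<lambda>q. LEAST n. q \<in> S n)"
  \<comment> \<open>A crude common bound on the ranks. States in no stage receive an arbitrary
    \<open>LEAST\<close> value, which does not affect the bound.\<close>
  define N where "N = (\<Sum>q\<in>Knw_states G. r q)"
  have bound: "r q \<le> N" if "q \<in> Knw_states G" for q
    unfolding N_def using that fin by (intro member_le_sum) auto
  have rS: "q \<in> S (r q)" if "q \<in> S n" for q n unfolding r_def using that by (rule LeastI)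
  have rle: "r q \<le> n" if "q \<in> S n" for q n unfolding r_def using that by (rule Least_le)
  have edge: "q' \<in> Knw_states G" if "(q, \<sigma>, q') \<in> delta (Knw G)" for q \<sigma> q'
    using that game_structureD(4)[OF H] by auto
  define Z where "Z = {q \<in> Knw_states G. fst q \<in> W \<and> (\<forall>n. q \<notin> S n)}"
  have "Z = {}"
  proof (rule safe_lettersD(5)[OF safe])
    fix q assume q: "q \<in> Z"
    have "\<exists>q'\<in>Z. (q, \<sigma>, q') \<in> delta (Knw G)" if \<sigma>: "\<sigma> \<in> A (fst q)" for \<sigma>
    proof (rule ccontr)
      assume no: "\<not> ?thesis"
      \<comment> \<open>Successors may enter the attractor at different stages; \<open>N\<close> is
        one stage that contains them all, which puts \<open>q\<close> into stage
        \<open>Suc N\<close>.\<close>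
      have "q' \<in> S N" if e: "(q, \<sigma>, q') \<in> delta (Knw G)" for q'
      proof -
        have "fst q' \<in> W" using safe_lettersD(4)[OF safe _ \<sigma> e] q by (simp add: Z_def)
        then obtain n where "q' \<in> S n" using no e edge[OF e] unfolding Z_def by blast
        then show ?thesis using rS mono[OF bound[OF edge[OF e]]] by blast
      qed
      then have "q \<in> S (Suc N)" using \<sigma> by (auto simp: SS)
      then show False using q by (auto simp: Z_def)
    qed
    moreover have "q \<notin> Knw_target G T" using q S0 by (auto simp: Z_def)
    ultimately show "q \<in> Knw_states G \<and> fst q \<in> W \<and> q \<notin> Knw_target G T \<and>
       (\<forall>\<sigma>\<in>A (fst q). \<exists>q'\<in>Z. (q, \<sigma>, q') \<in> delta (Knw G))"
      using q by (simp add: Z_def)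
  qed
  have "\<exists>\<sigma>\<in>A (fst q). \<forall>q'. (q, \<sigma>, q') \<in> delta (Knw G) \<longrightarrow> r q' < r q"
    if q: "q \<in> Knw_states G" "fst q \<in> W" "q \<notin> Knw_target G T" for q
  proof -
    obtain n where n: "q \<in> S n" using q \<open>Z = {}\<close> unfolding Z_def by blast
    then have "r q \<noteq> 0" using rS[OF n] q(3) S0 by metis
    then obtain k where k: "r q = Suc k" using not0_implies_Suc by blast
    then have "q \<notin> S k" using rle[of q k] by auto
    then obtain \<sigma> where "\<sigma> \<in> A (fst q)" "\<And>q'. (q, \<sigma>, q') \<in> delta (Knw G) \<Longrightarrow> q' \<in> S k"
      using rS[OF n] unfolding k SS by blast
    then show ?thesis using rle unfolding k less_Suc_eq_le by blast
  qed
  with bound show thesis using that by blast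
qed

text \<open>
  The prefixes of \<open>X\<close> cover the states of \<open>Knw G\<close> through a functional bisimulation \<open>\<kappa>\<close>. This
  treats \<open>G\<close> and \<open>Knw G\<close> alike, with \<open>eqv\<close> the indistinguishability of prefixes in either game.
\<close>

locale knowledge_cover =
  fixes G :: "('l, 's, 'o) game" and X :: "('x, 's, 'p) game" and T :: "'o set"
    and \<kappa> :: "('x, 's) prefix \<Rightarrow> 'l set \<times> 'l"
    and eqv :: "('x, 's) prefix \<Rightarrow> ('x, 's) prefix \<Rightarrow> bool" and B :: "'x set"
  assumes G: "game_structure G" and X: "game_structure X"
    and letters: "letters X = letters G" and nonempty: "letters G \<noteq> {}"
    and \<kappa>_init: "\<kappa> ([], init X) = ({init G}, init G)"
    and \<kappa>_step: "\<lbrakk>\<rho> \<in> Prefs X; (snd \<rho>, \<sigma>, x) \<in> delta X\<rbrakk> \<Longrightarrow> (\<kappa> \<rho>, \<sigma>, \<kappa> (extend \<rho> \<sigma> x)) \<in> delta (Knw G)"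
    and \<kappa>_lift: "\<lbrakk>\<rho> \<in> Prefs X; (\<kappa> \<rho>, \<sigma>, q) \<in> delta (Knw G)\<rbrakk> \<Longrightarrow>
      \<exists>x. (snd \<rho>, \<sigma>, x) \<in> delta X \<and> \<kappa> (extend \<rho> \<sigma> x) = q"
    and eqv_init: "eqv ([], init X) ([], init X)"
    and eqv_extend: "\<lbrakk>eqv \<rho> \<rho>'; extend \<rho> \<sigma> x \<in> Prefs X; extend \<rho>' \<sigma> x' \<in> Prefs X;
      fst (\<kappa> (extend \<rho> \<sigma> x)) = fst (\<kappa> (extend \<rho>' \<sigma> x'))\<rbrakk> \<Longrightarrow> eqv (extend \<rho> \<sigma> x) (extend \<rho>' \<sigma> x')"
    and target: "\<rho> \<in> Prefs X \<Longrightarrow> snd \<rho> \<in> B \<longleftrightarrow> \<kappa> \<rho> \<in> Knw_target G T"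
begin

lemma nonempty_X: "letters X \<noteq> {}"
  using letters nonempty by simp

lemma \<kappa>_state:
  assumes "\<rho> \<in> Prefs X"
  shows "\<kappa> \<rho> \<in> Knw_states G"
  using assms
proof (cases rule: Prefs_cases)
  case init
  then show ?thesis using \<kappa>_init game_structureD(2)[OF game_structure_Knw[OF G]] by simp
next
  case (extend \<rho>' \<sigma> x)
  then show ?thesis
    using \<kappa>_step[of \<rho>' \<sigma> x] game_structureD(4)[OF game_structure_Knw[OF G]] by auto
qed

text \<open>The hidden state is exchanged backwards: \<open>l\<close> has a predecessor
  \<open>l'\<close> in the previous knowledge, induction supplies an indistinguishable consistent
  prefix ending there, and \<alpha> plays the same letter on it. Lifting the edge to
  \<open>(s', l)\<close> extends that prefix.\<close>

lemma consistent_switch: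
  assumes resp: "\<And>\<rho> \<rho>'. \<lbrakk>\<rho> \<in> Prefs X; \<rho>' \<in> Prefs X; eqv \<rho> \<rho>'\<rbrakk> \<Longrightarrow> \<alpha> \<rho> = \<alpha> \<rho>'"
    and "\<rho> \<in> consistent X \<alpha>" "l \<in> fst (\<kappa> \<rho>)"
  shows "\<exists>\<rho>'\<in>consistent X \<alpha>. eqv \<rho> \<rho>' \<and> \<kappa> \<rho>' = (fst (\<kappa> \<rho>), l)"
  using assms(2,3)
proof (induction arbitrary: l)
  case init
  then show ?case using \<kappa>_init eqv_init consistent.init by force
next
  case (extend \<rho> \<sigma> x)
  note pref = consistent_Prefs[OF X nonempty_X]
  obtain s l0 where \<kappa>\<rho>: "\<kappa> \<rho> = (s, l0)" by (cases "\<kappa> \<rho>")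
  obtain s' l1 where \<kappa>e: "\<kappa> (extend \<rho> \<sigma> x) = (s', l1)" by (cases "\<kappa> (extend \<rho> \<sigma> x)")
  have e: "((s, l0), \<sigma>, (s', l1)) \<in> delta (Knw G)"
    using \<kappa>_step[OF pref[OF extend(1)] extend(3)] by (simp add: \<kappa>\<rho> \<kappa>e)
  then obtain b where b: "b \<in> observations G" "s' = Post G \<sigma> s \<inter> gamma G b" by (auto simp: delta_Knw_iff)
  have l: "l \<in> s'" using extend(5) \<kappa>e by simp
  then obtain l' where l': "l' \<in> s" "(l', \<sigma>, l) \<in> delta G" using b by (auto simp: Post_def)
  then obtain \<rho>' where \<rho>': "\<rho>' \<in> consistent X \<alpha>" "eqv \<rho> \<rho>'" "\<kappa> \<rho>' = (s, l')"
    using extend(4)[of l'] \<kappa>\<rho> by auto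
  have "((s, l'), \<sigma>, (s', l)) \<in> delta (Knw G)"
    using e l l' by (auto simp: delta_Knw_iff Knw_states_def)
  then obtain x' where x': "(snd \<rho>', \<sigma>, x') \<in> delta X" "\<kappa> (extend \<rho>' \<sigma> x') = (s', l)"
    using \<kappa>_lift[OF pref[OF \<rho>'(1)]] \<rho>'(3) by metis
  have "\<alpha> \<rho>' = \<alpha> \<rho>" using resp[OF pref pref] extend(1) \<rho>' by metis
  then have cons: "extend \<rho>' \<sigma> x' \<in> consistent X \<alpha>"
    using extend(2) x'(1) \<rho>'(1) by (auto intro: consistent.extend)
  have "eqv (extend \<rho> \<sigma> x) (extend \<rho>' \<sigma> x')"
    using eqv_extend[OF \<rho>'(2) pref[OF consistent.extend[OF extend(1-3)]] pref[OF cons]] x'(2) \<kappa>e by simp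
  then show ?case using cons x'(2) \<kappa>e by auto
qed

text \<open>A counterexample \<open>Z\<close> to the trap condition pulls back along \<kappa> to a
  set of prefixes in which Player 2 can answer every letter of \<alpha>, as these letters belong to
  \<open>A\<close> by construction.\<close>

lemma almost_winning_imp_safe_letters:
  assumes \<alpha>: "player1_strategy X \<alpha>"
    and resp: "\<And>\<rho> \<rho>'. \<lbrakk>\<rho> \<in> Prefs X; \<rho>' \<in> Prefs X; eqv \<rho> \<rho>'\<rbrakk> \<Longrightarrow> \<alpha> \<rho> = \<alpha> \<rho>'"
    and aw: "almost_winning X \<alpha> (Buchi_states X B)"
  shows "\<exists>W A. safe_letters G T W A"
proof -
  note pref = consistent_Prefs[OF X nonempty_X]
  define W where "W = (\<lambda>\<rho>. fst (\<kappa> \<rho>)) ` consistent X \<alpha>"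
  define A where "A = (\<lambda>s. \<Union>\<rho>\<in>{\<rho> \<in> consistent X \<alpha>. fst (\<kappa> \<rho>) = s}. set_pmf (\<alpha> \<rho>))"
  \<comment> \<open>Moves from a prefix with the right knowledge to one ending exactly at
    \<open>q\<close>, without changing the distribution of \<alpha>. Thus every letter of
    \<open>A (fst q)\<close> is available at \<open>q\<close> itself.\<close>
  have reach: "\<exists>\<rho>'\<in>consistent X \<alpha>. \<kappa> \<rho>' = q \<and> \<alpha> \<rho>' = \<alpha> \<rho>"
    if \<rho>: "\<rho> \<in> consistent X \<alpha>" "fst (\<kappa> \<rho>) = fst q" "q \<in> Knw_states G" for \<rho> q
  proof -
    have "snd q \<in> fst (\<kappa> \<rho>)" using \<rho> by (auto simp: Knw_states_def)
    then obtain \<rho>' where "\<rho>' \<in> consistent X \<alpha>" "eqv \<rho> \<rho>'" "\<kappa> \<rho>' = q"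
      using consistent_switch[OF resp \<rho>(1)] \<rho>(2) by (metis prod.collapse)
    then show ?thesis using resp[OF pref pref] \<rho>(1) by metis
  qed
  have edge: "q \<in> Knw_states G" if "(q, \<sigma>, q') \<in> delta (Knw G)" for q \<sigma> q'
    using that game_structureD(4)[OF game_structure_Knw[OF G]] by auto
  have init_W: "{init G} \<in> W"
    unfolding W_def using \<kappa>_init consistent.init[of X \<alpha>] by (auto intro!: image_eqI)
  have A: "A s \<noteq> {}" "A s \<subseteq> letters G" if s: "s \<in> W" for s
  proof -
    obtain \<rho> where "\<rho> \<in> consistent X \<alpha>" "fst (\<kappa> \<rho>) = s" using s by (auto simp: W_def)
    then show "A s \<noteq> {}" using set_pmf_not_empty[of "\<alpha> \<rho>"] unfolding A_def by blast
    show "A s \<subseteq> letters G"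
      using \<alpha> pref letters unfolding A_def player1_strategy_def by blast
  qed
  have closed: "fst q' \<in> W"
    if \<sigma>: "\<sigma> \<in> A (fst q)" and e: "(q, \<sigma>, q') \<in> delta (Knw G)" for q \<sigma> q'
  proof -
    obtain \<rho> where "\<rho> \<in> consistent X \<alpha>" "fst (\<kappa> \<rho>) = fst q" "\<sigma> \<in> set_pmf (\<alpha> \<rho>)"
      using \<sigma> by (auto simp: A_def)
    then obtain \<rho>' where \<rho>': "\<rho>' \<in> consistent X \<alpha>" "\<kappa> \<rho>' = q" "\<sigma> \<in> set_pmf (\<alpha> \<rho>')"
      using reach[OF _ _ edge[OF e]] by metis
    then obtain x where "(snd \<rho>', \<sigma>, x) \<in> delta X" "\<kappa> (extend \<rho>' \<sigma> x) = q'"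
      using \<kappa>_lift[OF pref[OF \<rho>'(1)]] e by metis
    then show ?thesis unfolding W_def
      using consistent.extend[OF \<rho>'(1,3)] by (metis image_eqI)
  qed
  have no_trap: "Z = {}"
    if Z: "\<And>q. q \<in> Z \<Longrightarrow> q \<in> Knw_states G \<and> fst q \<in> W \<and> q \<notin> Knw_target G T \<and>
       (\<forall>\<sigma>\<in>A (fst q). \<exists>q'\<in>Z. (q, \<sigma>, q') \<in> delta (Knw G))" for Z
  proof (rule ccontr)
    assume "Z \<noteq> {}"
    then obtain q where q: "q \<in> Z" by blast
    then obtain \<rho>0 where "\<rho>0 \<in> consistent X \<alpha>" "fst (\<kappa> \<rho>0) = fst q"
      using Z[OF q] by (auto simp: W_def)
    then obtain \<rho> where \<rho>: "\<rho> \<in> consistent X \<alpha>" "\<kappa> \<rho> = q" using reach Z[OF q] by blast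
    define Y where "Y = {\<rho> \<in> Prefs X. \<kappa> \<rho> \<in> Z}"
    have "\<not> almost_winning X \<alpha> (Buchi_states X B)"
    proof (rule trap_not_almost_winning[OF X nonempty_X \<alpha> \<rho>(1)])
      show "\<rho> \<in> Y" using \<rho> q pref by (simp add: Y_def)
      show "snd \<tau> \<notin> B" if "\<tau> \<in> Y" for \<tau> using that Z target by (auto simp: Y_def)
      show "\<exists>x. (snd \<tau>, \<sigma>, x) \<in> delta X \<and> extend \<tau> \<sigma> x \<in> Y"
        if \<tau>: "\<tau> \<in> consistent X \<alpha>" "\<tau> \<in> Y" and \<sigma>: "\<sigma> \<in> set_pmf (\<alpha> \<tau>)" for \<tau> \<sigma>
      proof -
        have "\<sigma> \<in> A (fst (\<kappa> \<tau>))" using \<tau>(1) \<sigma> unfolding A_def by blast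
        then obtain q' where q': "q' \<in> Z" "(\<kappa> \<tau>, \<sigma>, q') \<in> delta (Knw G)"
          using Z[of "\<kappa> \<tau>"] \<tau>(2) unfolding Y_def by blast
        then obtain x where "(snd \<tau>, \<sigma>, x) \<in> delta X" "\<kappa> (extend \<tau> \<sigma> x) = q'"
          using \<kappa>_lift[OF pref[OF \<tau>(1)]] by metis
        then show ?thesis using Prefs_extend[OF X pref[OF \<tau>(1)]] q'(1) by (auto simp: Y_def)
      qed
    qed
    with aw show False by contradiction
  qed
  have "safe_letters G T W A"
    unfolding safe_letters_def
  proof (intro conjI ballI allI impI)
    show "fst q' \<in> W" if "\<sigma> \<in> A (fst q)" "(q, \<sigma>, q') \<in> delta (Knw G)" for q \<sigma> q'
      using that by (rule closed)
  qed (rule init_W, erule A(1), erule A(2), rule no_trap, erule (1) bspec)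
  then show ?thesis by blast
qed

text \<open>The strategy factors through the knowledge \<open>fst (\<kappa> \<rho>)\<close>; in each
  of the two games this yields the required form of the strategy at once.\<close>

lemma safe_letters_imp_almost_winning:
  assumes safe: "safe_letters G T W A"
  shows "\<exists>f. player1_strategy X (\<lambda>\<rho>. f (fst (\<kappa> \<rho>))) \<and>
    almost_winning X (\<lambda>\<rho>. f (fst (\<kappa> \<rho>))) (Buchi_states X B)"
proof -
  note pref = consistent_Prefs[OF X nonempty_X]
  \<comment> \<open>Off \<open>W\<close>, which no consistent prefix reaches, the whole alphabet
    serves as a default that keeps the strategy legal.\<close>
  define f where "f = (\<lambda>s. pmf_of_set (if s \<in> W then A s else letters G))"
  let ?\<alpha> = "\<lambda>\<rho>. f (fst (\<kappa> \<rho>))"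
  have finl: "finite (letters G)" by (rule game_structureD(3)[OF G])
  have A: "A s \<noteq> {}" "A s \<subseteq> letters G" "finite (A s)" if "s \<in> W" for s
    using safe_lettersD(2,3)[OF safe that] finl finite_subset by auto
  have set_f: "set_pmf (f s) = (if s \<in> W then A s else letters G)" for s
    unfolding f_def using A finl nonempty by (intro set_pmf_of_set) auto
  have \<alpha>: "player1_strategy X ?\<alpha>"
    unfolding player1_strategy_def set_f using A letters by auto
  obtain r :: "'l set \<times> 'l \<Rightarrow> nat" and N where
    r: "\<And>q. q \<in> Knw_states G \<Longrightarrow> r q \<le> N"
      "\<And>q. q \<in> Knw_states G \<Longrightarrow> fst q \<in> W \<Longrightarrow> q \<notin> Knw_target G T \<Longrightarrow>
       \<exists>\<sigma>\<in>A (fst q). \<forall>q'. (q, \<sigma>, q') \<in> delta (Knw G) \<longrightarrow> r q' < r q"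
    using safe_letters_rank[OF G safe] by blast
  have inW: "fst (\<kappa> \<rho>) \<in> W" if "\<rho> \<in> consistent X ?\<alpha>" for \<rho>
    using that
  proof induction
    case init then show ?case using \<kappa>_init safe_lettersD(1)[OF safe] by simp
  next
    case (extend \<rho> \<sigma> x)
    then show ?case
      using safe_lettersD(4)[OF safe extend(4) _ \<kappa>_step[OF pref]] by (simp add: set_f)
  qed
  have "almost_winning X ?\<alpha> (Buchi_states X B)"
  \<comment> \<open>A uniform choice from \<open>A s\<close> gives each letter probability
    \<open>1 / card (A s)\<close>, and \<open>A s\<close> is contained in the alphabet; this is the
    origin of the bound.\<close>
  proof (rule rank_almost_winning[OF X nonempty_X \<alpha>, where r = "\<lambda>\<rho>. r (\<kappa> \<rho>)" and N = N
        and \<epsilon> = "1 / real (card (letters G))"])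
    show "r (\<kappa> \<rho>) \<le> N" if "\<rho> \<in> consistent X ?\<alpha>" for \<rho>
      using r(1) \<kappa>_state pref[OF that] by blast
    show "0 < 1 / real (card (letters G))" using finl nonempty by (simp add: card_gt_0_iff)
    show "\<exists>\<sigma>. 1 / real (card (letters G)) \<le> pmf (f (fst (\<kappa> \<rho>))) \<sigma> \<and>
        (\<forall>x. (snd \<rho>, \<sigma>, x) \<in> delta X \<longrightarrow> r (\<kappa> (extend \<rho> \<sigma> x)) < r (\<kappa> \<rho>))"
      if \<rho>: "\<rho> \<in> consistent X ?\<alpha>" "snd \<rho> \<notin> B" for \<rho>
    proof -
      let ?s = "fst (\<kappa> \<rho>)"
      have W: "?s \<in> W" by (rule inW[OF \<rho>(1)])
      obtain \<sigma> where \<sigma>: "\<sigma> \<in> A ?s" "\<forall>q'. (\<kappa> \<rho>, \<sigma>, q') \<in> delta (Knw G) \<longrightarrow> r q' < r (\<kappa> \<rho>)"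
        using r(2)[OF \<kappa>_state[OF pref[OF \<rho>(1)]] W] target[OF pref[OF \<rho>(1)]] \<rho>(2) by blast
      have "card (A ?s) \<le> card (letters G)" "0 < card (A ?s)"
        using A[OF W] finl by (auto simp: card_mono card_gt_0_iff)
      then have "1 / real (card (letters G)) \<le> pmf (f ?s) \<sigma>"
        using W A[OF W] \<sigma>(1) by (simp add: f_def frac_le)
      then show ?thesis using \<sigma>(2) \<kappa>_step[OF pref[OF \<rho>(1)]] by blast
    qed
  qed
  with \<alpha> show ?thesis by blast
qed

end

section \<open>The two covers\<close>

text \<open>The trivial cover: the last state of a prefix of \<open>Knw G\<close> already is its
  knowledge together with the current state.\<close>

lemma knowledge_cover_Knw:
  assumes "game_structure G" "letters G \<noteq> {}"
  shows "knowledge_cover G (Knw G) T snd prefix_equiv (Knw_target G T)"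
proof
  show "prefix_equiv (extend \<rho> \<sigma> x) (extend \<rho>' \<sigma> x')"
    if "prefix_equiv \<rho> \<rho>'" "fst (snd (extend \<rho> \<sigma> x)) = fst (snd (extend \<rho>' \<sigma> x'))" for \<rho> \<rho>' \<sigma> x x'
    using that by (auto simp: prefix_equiv_def extend_def state_equiv_def intro!: list_all2_appendI)
qed (use assms in \<open>auto simp: game_structure_Knw prefix_equiv_def state_equiv_def\<close>)

section \<open>Observations and knowledge along prefixes of \<open>G\<close>\<close>

lemma
  assumes "game_structure G"
  shows obs_of_eq: "b \<in> observations G \<Longrightarrow> l \<in> gamma G b \<Longrightarrow> obs_of G l = b"
    and obs_of_observation: "l \<in> states G \<Longrightarrow> obs_of G l \<in> observations G"
    and mem_gamma_obs_of: "l \<in> states G \<Longrightarrow> l \<in> gamma G (obs_of G l)"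
proof -
  have disj: "b = b'" if "b \<in> observations G" "b' \<in> observations G" "l \<in> gamma G b" "l \<in> gamma G b'" for b b' l
    using assms that unfolding game_structure_def by blast
  show eq: "obs_of G l = b" if "b \<in> observations G" "l \<in> gamma G b" for b l
    unfolding obs_of_def using that disj by blast
  assume "l \<in> states G"
  then obtain b where "b \<in> observations G" "l \<in> gamma G b"
    using assms unfolding game_structure_def by blast
  then show "obs_of G l \<in> observations G" "l \<in> gamma G (obs_of G l)" using eq by auto
qed

lemma obs_seq_extend:
  "obs_seq G (extend \<rho> \<sigma> l) = (fst (obs_seq G \<rho>) @ [(snd (obs_seq G \<rho>), \<sigma>)], obs_of G l)"
  by (simp add: obs_seq_def extend_def)

text \<open>Defined through indistinguishable prefixes rather than by iterating \<open>Post\<close>,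
  so that any function of the knowledge is observation-based by definition. The iteration is
  recovered in \<open>knowledge_extend\<close>.\<close>

definition knowledge :: "('l, 's, 'o) game \<Rightarrow> ('l, 's) prefix \<Rightarrow> 'l set" where
  "knowledge G \<rho> = snd ` {\<rho>' \<in> Prefs G. obs_seq G \<rho>' = obs_seq G \<rho>}"

lemma knowledge_self: "\<rho> \<in> Prefs G \<Longrightarrow> snd \<rho> \<in> knowledge G \<rho>"
  by (auto simp: knowledge_def)

lemma obs_of_knowledge: "l \<in> knowledge G \<rho> \<Longrightarrow> obs_of G l = obs_of G (snd \<rho>)"
  by (auto simp: knowledge_def obs_seq_def)

text \<open>Observation sequences record letters, so dropping or appending a last step with letter
  \<sigma> preserves indistinguishability as long as the final observations agree. The right-hand
  side is the update used by \<open>Knw\<close>.\<close>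

lemma knowledge_extend:
  assumes G: "game_structure G" and \<rho>: "\<rho> \<in> Prefs G" and e: "(snd \<rho>, \<sigma>, l) \<in> delta G"
  shows "knowledge G (extend \<rho> \<sigma> l) = Post G \<sigma> (knowledge G \<rho>) \<inter> gamma G (obs_of G l)"
proof (intro set_eqI iffI)
  fix l' assume "l' \<in> knowledge G (extend \<rho> \<sigma> l)"
  then obtain \<tau> where \<tau>: "\<tau> \<in> Prefs G" "obs_seq G \<tau> = obs_seq G (extend \<rho> \<sigma> l)" "l' = snd \<tau>"
    by (auto simp: knowledge_def)
  from \<tau>(1) show "l' \<in> Post G \<sigma> (knowledge G \<rho>) \<inter> gamma G (obs_of G l)"
  proof (cases rule: Prefs_cases)
    case init
    then show ?thesis using \<tau>(2) by (simp add: obs_seq_extend) (simp add: obs_seq_def)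
  next
    case (extend \<tau>' \<sigma>' l'')
    then have eq: "obs_seq G \<tau>' = obs_seq G \<rho>" "\<sigma>' = \<sigma>" "obs_of G l'' = obs_of G l"
      using \<tau>(2) unfolding extend(1) obs_seq_extend by (auto intro: prod_eqI)
    have "snd \<tau>' \<in> knowledge G \<rho>" using extend(2) eq(1) by (auto simp: knowledge_def)
    moreover have "l'' \<in> gamma G (obs_of G l)"
      using mem_gamma_obs_of[OF G] game_structureD(4)[OF G] extend(3) eq(3) by (metis mem_Sigma_iff subsetD)
    ultimately show ?thesis using extend \<tau>(3) eq(2) by (auto simp: Post_def)
  qed
next
  fix l' assume l': "l' \<in> Post G \<sigma> (knowledge G \<rho>) \<inter> gamma G (obs_of G l)"
  then obtain \<tau> where \<tau>: "\<tau> \<in> Prefs G" "obs_seq G \<tau> = obs_seq G \<rho>" "(snd \<tau>, \<sigma>, l') \<in> delta G"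
    by (auto simp: Post_def knowledge_def)
  have "l \<in> states G" using e game_structureD(4)[OF G] by auto
  then have "obs_of G l' = obs_of G l" using l' obs_of_eq[OF G obs_of_observation[OF G]] by blast
  then have "obs_seq G (extend \<tau> \<sigma> l') = obs_seq G (extend \<rho> \<sigma> l)" by (simp add: obs_seq_extend \<tau>(2))
  then show "l' \<in> knowledge G (extend \<rho> \<sigma> l)"
    unfolding knowledge_def using Prefs_extend[OF G \<tau>(1,3)] by force
qed

text \<open>Edges of \<open>Knw G\<close> lift because the new state \<open>l\<close> determines the
  observation that cuts down the new knowledge set; playing to \<open>l\<close> in \<open>G\<close>
  therefore reproduces both components.\<close>

lemma knowledge_cover_G:
  assumes G: "game_structure G" and ne: "letters G \<noteq> {}" and T: "T \<subseteq> observations G"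
  shows "knowledge_cover G G T (\<lambda>\<rho>. (knowledge G \<rho>, snd \<rho>)) (\<lambda>\<rho> \<rho>'. obs_seq G \<rho> = obs_seq G \<rho>')
    (\<Union>b\<in>T. gamma G b)"
proof
  have sub: "knowledge G \<rho> \<subseteq> gamma G (obs_of G (snd \<rho>))" if "\<rho> \<in> Prefs G" for \<rho>
  proof
    fix l assume l: "l \<in> knowledge G \<rho>"
    then have "l \<in> states G" using Prefs_state[OF G] by (auto simp: knowledge_def)
    then show "l \<in> gamma G (obs_of G (snd \<rho>))" using mem_gamma_obs_of[OF G] obs_of_knowledge[OF l] by metis
  qed
  have state: "(knowledge G \<rho>, snd \<rho>) \<in> Knw_states G" if "\<rho> \<in> Prefs G" for \<rho>
    using sub[OF that] knowledge_self[OF that] obs_of_observation[OF G Prefs_state[OF G that]]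
    by (auto simp: Knw_states_def)
  show "(knowledge G ([], init G), snd ([] :: ('a \<times> 'b) list, init G)) = ({init G}, init G)"
  proof -
    have "\<tau> = ([], init G)" if "\<tau> \<in> Prefs G" "obs_seq G \<tau> = obs_seq G ([], init G)" for \<tau>
      using that(1)
      by (cases rule: Prefs_cases) (use that(2) in \<open>auto simp: obs_seq_extend\<close>, auto simp: obs_seq_def)
    then have "{\<tau> \<in> Prefs G. obs_seq G \<tau> = obs_seq G ([], init G)} = {([], init G)}"
      using Prefs_init[OF G ne] by blast
    then show ?thesis by (simp add: knowledge_def)
  qed
  show "((knowledge G \<rho>, snd \<rho>), \<sigma>, (knowledge G (extend \<rho> \<sigma> x), snd (extend \<rho> \<sigma> x))) \<in> delta (Knw G)"
    if \<rho>: "\<rho> \<in> Prefs G" and e: "(snd \<rho>, \<sigma>, x) \<in> delta G" for \<rho> \<sigma> x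
    using state[OF \<rho>] state[OF Prefs_extend[OF G \<rho> e]] knowledge_extend[OF G \<rho> e] e
      obs_of_observation[OF G] Prefs_state[OF G Prefs_extend[OF G \<rho> e]]
    by (auto simp: delta_Knw_iff)
  show "\<exists>x. (snd \<rho>, \<sigma>, x) \<in> delta G \<and> (knowledge G (extend \<rho> \<sigma> x), snd (extend \<rho> \<sigma> x)) = q"
    if \<rho>: "\<rho> \<in> Prefs G" and e: "((knowledge G \<rho>, snd \<rho>), \<sigma>, q) \<in> delta (Knw G)" for \<rho> \<sigma> q
  proof -
    obtain s l where q: "q = (s, l)" by (cases q)
    with e obtain b where b: "b \<in> observations G" "s = Post G \<sigma> (knowledge G \<rho>) \<inter> gamma G b"
      and l: "l \<in> s" "(snd \<rho>, \<sigma>, l) \<in> delta G"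
      by (auto simp: delta_Knw_iff Knw_states_def)
    then have "obs_of G l = b" using obs_of_eq[OF G] by blast
    then show ?thesis using knowledge_extend[OF G \<rho> l(2)] b l q by auto
  qed
  show "obs_seq G (extend \<rho> \<sigma> x) = obs_seq G (extend \<rho>' \<sigma> x')"
    if "obs_seq G \<rho> = obs_seq G \<rho>'" "extend \<rho> \<sigma> x \<in> Prefs G"
      "fst (knowledge G (extend \<rho> \<sigma> x), snd (extend \<rho> \<sigma> x)) =
       fst (knowledge G (extend \<rho>' \<sigma> x'), snd (extend \<rho>' \<sigma> x'))" for \<rho> \<rho>' \<sigma> x x'
  proof -
    \<comment> \<open>All states of one knowledge set share an observation, so equal knowledge after
      the step forces equal last observations.\<close>
    have "x \<in> knowledge G (extend \<rho>' \<sigma> x')" using knowledge_self[OF that(2)] that(3) by simp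
    then have "obs_of G x = obs_of G x'" using obs_of_knowledge by fastforce
    then show ?thesis using that(1) by (simp add: obs_seq_extend)
  qed
  show "snd \<rho> \<in> (\<Union>b\<in>T. gamma G b) \<longleftrightarrow> (knowledge G \<rho>, snd \<rho>) \<in> Knw_target G T" if \<rho>: "\<rho> \<in> Prefs G" for \<rho>
  proof
    assume "snd \<rho> \<in> (\<Union>b\<in>T. gamma G b)"
    then obtain b where "b \<in> T" "snd \<rho> \<in> gamma G b" by blast
    \<comment> \<open>As \<open>T\<close> consists of observations, \<open>b\<close> is the
      observation of the last state, and the whole knowledge set lies inside its class.\<close>
    then have "b \<in> T" "knowledge G \<rho> \<subseteq> gamma G b" using sub[OF \<rho>] obs_of_eq[OF G] T by auto
    then show "(knowledge G \<rho>, snd \<rho>) \<in> Knw_target G T" using state[OF \<rho>] by (auto simp: Knw_target_def)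
  next
    assume "(knowledge G \<rho>, snd \<rho>) \<in> Knw_target G T"
    then show "snd \<rho> \<in> (\<Union>b\<in>T. gamma G b)" using knowledge_self[OF \<rho>] by (auto simp: Knw_target_def)
  qed
qed (use G ne in auto)

text \<open>Pigeonhole: if a finite union of classes is visited infinitely often, so is one of the
  classes.\<close>

lemma Buchi_eq_Buchi_states:
  assumes "finite T"
  shows "Buchi G T = Buchi_states G (\<Union>b\<in>T. gamma G b)"
  by (simp add: Buchi_def Buchi_states_def INFM_finite_Bex_distrib[OF assms])

theorem theorem4p12:
  fixes G :: "('l, 's, 'o) game" and T :: "'o set"
  assumes "game_structure G" and "T \<subseteq> observations G"
  shows "(\<exists>\<alpha>. player1_strategy G \<alpha> \<and> observation_based G \<alpha> \<and> almost_winning G \<alpha> (Buchi G T)) \<longleftrightarrow>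
    (\<exists>\<alpha>. player1_strategy (Knw G) \<alpha> \<and> equivalence_preserving (Knw G) \<alpha> \<and> positional (Knw G) \<alpha> \<and>
       almost_winning (Knw G) \<alpha> (Buchi_states (Knw G) (Knw_target G T)))"
    (is "?L \<longleftrightarrow> ?R")
proof -
  let ?B = "\<Union>b\<in>T. gamma G b"
  have Buchi: "Buchi G T = Buchi_states G ?B"
    using Buchi_eq_Buchi_states finite_subset[OF assms(2) game_structureD(6)[OF assms(1)]] by blast
  show ?thesis
  proof
    assume ?L
    then obtain \<alpha> where \<alpha>: "player1_strategy G \<alpha>" "observation_based G \<alpha>"
      "almost_winning G \<alpha> (Buchi_states G ?B)" unfolding Buchi by blast
    have ne: "letters G \<noteq> {}"
      by (rule almost_winning_letters[OF assms(1) \<alpha>(3)]) (auto simp: Buchi_states_def)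
    interpret G: knowledge_cover G G T "\<lambda>\<rho>. (knowledge G \<rho>, snd \<rho>)" "\<lambda>\<rho> \<rho>'. obs_seq G \<rho> = obs_seq G \<rho>'" ?B
      by (rule knowledge_cover_G[OF assms(1) ne assms(2)])
    interpret H: knowledge_cover G "Knw G" T snd prefix_equiv "Knw_target G T"
      by (rule knowledge_cover_Knw[OF assms(1) ne])
    obtain W A where "safe_letters G T W A"
      using G.almost_winning_imp_safe_letters[OF \<alpha>(1) _ \<alpha>(3)] \<alpha>(2) unfolding observation_based_def by blast
    then obtain f where "player1_strategy (Knw G) (\<lambda>\<rho>. f (fst (snd \<rho>)))"
      "almost_winning (Knw G) (\<lambda>\<rho>. f (fst (snd \<rho>))) (Buchi_states (Knw G) (Knw_target G T))"
      using H.safe_letters_imp_almost_winning by blast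
    \<comment> \<open>Equal last states and equivalent prefixes both have the same knowledge
      component, the only input of \<open>f\<close>.\<close>
    then show ?R
      by (intro exI[of _ "\<lambda>\<rho>. f (fst (snd \<rho>))"])
        (simp add: equivalence_preserving_def positional_def prefix_equiv_def state_equiv_def)
  next
    assume ?R
    then obtain \<alpha> where \<alpha>: "player1_strategy (Knw G) \<alpha>" "equivalence_preserving (Knw G) \<alpha>"
      "almost_winning (Knw G) \<alpha> (Buchi_states (Knw G) (Knw_target G T))" by blast
    have "letters (Knw G) \<noteq> {}"
      by (rule almost_winning_letters[OF game_structure_Knw[OF assms(1)] \<alpha>(3)]) (auto simp: Buchi_states_def)
    then have ne: "letters G \<noteq> {}" by simp
    interpret G: knowledge_cover G G T "\<lambda>\<rho>. (knowledge G \<rho>, snd \<rho>)" "\<lambda>\<rho> \<rho>'. obs_seq G \<rho> = obs_seq G \<rho>'" ?B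
      by (rule knowledge_cover_G[OF assms(1) ne assms(2)])
    interpret H: knowledge_cover G "Knw G" T snd prefix_equiv "Knw_target G T"
      by (rule knowledge_cover_Knw[OF assms(1) ne])
    obtain W A where "safe_letters G T W A"
      using H.almost_winning_imp_safe_letters[OF \<alpha>(1) _ \<alpha>(3)] \<alpha>(2) unfolding equivalence_preserving_def by blast
    then obtain f where "player1_strategy G (\<lambda>\<rho>. f (knowledge G \<rho>))"
      "almost_winning G (\<lambda>\<rho>. f (knowledge G \<rho>)) (Buchi_states G ?B)"
      using G.safe_letters_imp_almost_winning by auto
    moreover have "observation_based G (\<lambda>\<rho>. f (knowledge G \<rho>))"
      by (simp add: observation_based_def knowledge_def)
    ultimately show ?L unfolding Buchi by blast
  qed
qed

end
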